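(* Consider a line network with locations $1,\dots,n$ and detection rates $\lambda_1,\dots,\lambda_n>0$. Then the best sweep cycle outperforms the best simple cycle: the infimum of $\max_{i} v_i$ over all sweep cycles is strictly smaller than the infimum of $\max_i v_i$ over all simple cycles.
   Context: There are travel times $d_{ij}>0$ for $i\ne j$ (not necessarily symmetric), $d_{ii}=0$, satisfying the triangle inequality. The locations form a line network if $d_{ij}=\sum_{k=i}^{j-1}d_{k,k+1}$ for $i<j$ and $d_{ij}=\sum_{k=j+1}^{i}d_{k,k-1}$ for $i>j$. A patrol pattern is a finite sequence $((x_1,t_1),\dots,(x_m,t_m))$ of locations and search durations: the patroller searches location $x_1$ for time $t_1$, travels to $x_2$ (taking $d_{x_1x_2}$), searches there for time $t_2$, and so on, and after $(x_m,t_m)$ travels to $x_1$ and repeats the pattern forever. Let $c$ be the length of one cycle (search plus travel time). While the patroller is searching location $i$, an attacker present there is detected at instantaneous rate $\lambda_i$; otherwise (in particular while the patroller is traveling) it is not detected. So an attacker who arrives at location $i$ at time $t$ is undetected at time $t+u$ with probability $e^{-\lambda_i S_i(t,t+u)}$, where $S_i(t,t+u)$ is the time spent searching location $i$ during $[t,t+u]$. For a given patrol pattern, $v_i$ denotes the expected time to detect an attacker at location $i$ whose arrival time is uniform on one cycle: $v_i=\frac1c\int_0^c\int_0^\infty e^{-\lambda_iS_i(t,t+u)}\,du\,dt$. The performance of a pattern is $\max_{i}v_i$ (smaller is better). A simple cycle is a pattern in which each location appears exactly once, in any order, with positive search durations. A sweep cycle is given by $(x_1,\dots,x_{2n})$ with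 all $x_k>0$: the patroller visits $1,2,\dots,n$ in this order, searching location $i$ for time $x_i$, and then returns through $n,n-1,\dots,1$, searching location $i$ for time $x_{2n+1-i}$ (the two searches at location $n$ are consecutive, as are the last search at location $1$ and the first search at location $1$ in the next cycle), and repeats. Its cycle length is $\sum_{k=1}^{2n}x_k+\sum_{j=1}^{n-1}(d_{j,j+1}+d_{j+1,j})$.
   Formalization: The number of locations is assumed to be n ≥ 3; for n = 1 all cycles have v_1 = 1/λ_1 and for n = 2 every sweep cycle is a time shift of a simple cycle and conversely, so the two infima coincide and the strict inequality fails. *)

theory Defs
  imports "HOL-Analysis.Analysis"
begin

text \<open>Locations are the numbers \<open>1, \<dots>, n\<close>; \<open>d i j\<close> is the travel time from \<open>i\<close> to \<open>j\<close>
  and \<open>lam i\<close> the detection rate at location \<open>i\<close>.\<close>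

definition travel_times :: "nat \<Rightarrow> (nat \<Rightarrow> nat \<Rightarrow> real) \<Rightarrow> bool" where
  "travel_times n d \<longleftrightarrow>
     (\<forall>i\<in>{1..n}. d i i = 0) \<and>
     (\<forall>i\<in>{1..n}. \<forall>j\<in>{1..n}. i \<noteq> j \<longrightarrow> d i j > 0) \<and>
     (\<forall>i\<in>{1..n}. \<forall>j\<in>{1..n}. \<forall>k\<in>{1..n}. d i k \<le> d i j + d j k)"

definition line_network :: "nat \<Rightarrow> (nat \<Rightarrow> nat \<Rightarrow> real) \<Rightarrow> bool" where
  "line_network n d \<longleftrightarrow>
     travel_times n d \<and>
     (\<forall>i\<in>{1..n}. \<forall>j\<in>{1..n}.
        (i < j \<longrightarrow> d i j = (\<Sum>k=i..<j. d k (k + 1))) \<and>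
        (i > j \<longrightarrow> d i j = (\<Sum>k=j+1..i. d k (k - 1))))"

text \<open>A patrol pattern lists the pairs (location, search duration). Positions count from 0.\<close>

type_synonym pattern = "(nat \<times> real) list"

text \<open>The time at which the search in position \<open>k\<close> of the first cycle begins. Because of the
  index modulo the length, position \<open>length p\<close> stands for the return to the first location,
  so the value there is the cycle length.\<close>

definition start_time :: "(nat \<Rightarrow> nat \<Rightarrow> real) \<Rightarrow> pattern \<Rightarrow> nat \<Rightarrow> real" where
  "start_time d p k =
     (\<Sum>j<k. snd (p ! j) + d (fst (p ! j)) (fst (p ! ((j + 1) mod length p))))"

definition cycle_length :: "(nat \<Rightarrow> nat \<Rightarrow> real) \<Rightarrow> pattern \<Rightarrow> real" where
  "cycle_length d p = start_time d p (length p)"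

text \<open>All times at which location \<open>i\<close> is being searched; \<open>r\<close> counts the completed cycles.\<close>

definition search_times :: "(nat \<Rightarrow> nat \<Rightarrow> real) \<Rightarrow> pattern \<Rightarrow> nat \<Rightarrow> real set" where
  "search_times d p i =
     (\<Union>r::nat. \<Union>k\<in>{k. k < length p \<and> fst (p ! k) = i}.
        {real r * cycle_length d p + start_time d p k ..<
         real r * cycle_length d p + start_time d p k + snd (p ! k)})"

definition search_amount ::
  "(nat \<Rightarrow> nat \<Rightarrow> real) \<Rightarrow> pattern \<Rightarrow> nat \<Rightarrow> real \<Rightarrow> real \<Rightarrow> real" where
  "search_amount d p i s t = measure lborel (search_times d p i \<inter> {s..t})"

text \<open>The expected detection time is extended-real valued, so that a location which is never
  searched has detection time \<open>\<infinity>\<close>.\<close>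

definition detection_time ::
  "(nat \<Rightarrow> nat \<Rightarrow> real) \<Rightarrow> (nat \<Rightarrow> real) \<Rightarrow> pattern \<Rightarrow> nat \<Rightarrow> ennreal" where
  "detection_time d lam p i =
     (\<integral>\<^sup>+ t \<in> {0..cycle_length d p}.
        (\<integral>\<^sup>+ u \<in> {0..}. ennreal (exp (- lam i * search_amount d p i t (t + u))) \<partial>lborel)
      \<partial>lborel) / ennreal (cycle_length d p)"

definition performance ::
  "nat \<Rightarrow> (nat \<Rightarrow> nat \<Rightarrow> real) \<Rightarrow> (nat \<Rightarrow> real) \<Rightarrow> pattern \<Rightarrow> ennreal" where
  "performance n d lam p = Max (detection_time d lam p ` {1..n})"

definition simple_cycles :: "nat \<Rightarrow> pattern set" where
  "simple_cycles n =
     {p. distinct (map fst p) \<and> set (map fst p) = {1..n} \<and> (\<forall>t \<in> set (map snd p). t > 0)}"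

text \<open>The sweep \<open>1, \<dots>, n, n, \<dots>, 1\<close>: the repeated visits to \<open>n\<close> and (across the end of the cycle)
  to \<open>1\<close> are consecutive searches, since \<open>d n n = d 1 1 = 0\<close>.\<close>

definition sweep_pattern :: "nat \<Rightarrow> real list \<Rightarrow> pattern" where
  "sweep_pattern n xs = zip ([1..<n+1] @ rev [1..<n+1]) xs"

definition sweep_cycles :: "nat \<Rightarrow> pattern set" where
  "sweep_cycles n =
     {sweep_pattern n xs | xs. length xs = 2 * n \<and> (\<forall>x \<in> set xs. x > 0)}"

end

theory Submission
  imports Defs
begin

text \<open>
Searching a location twice per cycle, half as long each time, is better than searching it once, because
it splits the time during which the location is left alone. In a sweep cycle this happens at every
interior location, and no tour of a line network travels less than a sweep does. The work is to turn
this into a strict inequality between two infima.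

Let a location with detection rate \<open>lam\<close> be searched in two equal parts, for a total time \<open>x\<close> per
cycle of length \<open>c\<close>, and let \<open>g1 + g2 = c - x\<close> be the two gaps. Its mean detection time is
\<open>((2 * c - x) / lam + (c - x)\<^sup>2 / (2 * tanh (lam * x / 2)) - g1 * g2 * tanh (lam * x / 4)) / c\<close>
(lemma \<open>detection_time_two_searches\<close>). For a simple cycle one of the gaps is zero; so it is at the two
end locations of a sweep, whereas interior locations of a sweep have \<open>g1 * g2 > 0\<close>.

By the triangle inequality every simple cycle travels at least from \<open>1\<close> to \<open>n\<close> and back
(\<open>round_trip_le_tour\<close>), and for fixed search times the mean detection time increases with the cycle
length (\<open>mean_time_mono\<close>). So a simple cycle performs no better than the formula with
\<open>g1 * g2 = 0\<close> and the travel time of a sweep, maximised over the locations. As a function of the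
search times this maximum has a minimiser \<open>x\<close>, because it is continuous and large outside a compact
box (\<open>worst_time_attains_min\<close>).

The sweep with the search times \<open>x\<close>, divided equally between the two visits, has the same value at the two
ends and a strictly smaller one at each interior location. As \<open>n \<ge> 3\<close>, location \<open>2\<close> is interior and
has some slack, so its search time can be shortened slightly, which shortens the cycle and strictly
improves the ends (\<open>sweep_improves_simple\<close>). One sweep thus performs strictly better than a value that
bounds the performance of all simple cycles from below.
\<close>

section \<open>The remaining detection time under periodic search\<close>

lemma antiderivative_real_line:
  fixes f :: "real \<Rightarrow> real"
  assumes "continuous_on UNIV f"
  obtains F where "\<And>x. (F has_real_derivative f x) (at x)"
proof -
  have "\<exists>F. \<forall>x::real. -\<infinity> < ereal x \<longrightarrow> ereal x < \<infinity> \<longrightarrow> (F has_vector_derivative f x) (at x)"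
    using assms by (intro einterval_antiderivative) (auto simp: continuous_on_eq_continuous_at)
  then obtain F where "\<And>x. (F has_vector_derivative f x) (at x)"
    by auto
  then show ?thesis
    using that[of F] by (simp add: has_real_derivative_iff_has_vector_derivative)
qed

text \<open>Let \<open>A t\<close> be the amount of search spent on a location up to time \<open>t\<close>, growing by \<open>\<sigma>\<close> in each
cycle of length \<open>c\<close>. Instead of unrolling the cycles as a geometric series for the expected
remaining time \<open>h t\<close>, take an antiderivative \<open>H\<close> of \<open>exp (- lam * A t)\<close>. Periodicity of \<open>A\<close> makes
\<open>H\<close> satisfy \<open>H (t + c) = H c + r * H t\<close> for \<open>H 0 = 0\<close> and \<open>r = exp (- lam * \<sigma>) < 1\<close>, hence bounded
with a limit \<open>T\<close>, and the fundamental theorem of calculus gives \<open>h t = exp (lam * A t) * (T - H t)\<close>,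
a finite number. The third conclusion expresses that \<open>h c = h 0\<close>.\<close>
lemma survival_integral_periodic:
  fixes A :: "real \<Rightarrow> real"
  assumes "lam > 0" "\<sigma> > 0" "c > 0"
    and cont: "continuous_on UNIV A"
    and periodic: "\<And>t. t \<ge> 0 \<Longrightarrow> A (t + c) = A t + \<sigma>"
  obtains T H where
    "\<And>t. (H has_real_derivative exp (- lam * A t)) (at t)"
    "\<And>t. H t < T"
    "T - H c = exp (- lam * \<sigma>) * (T - H 0)"
    "\<And>t. t \<ge> 0 \<Longrightarrow> (\<integral>\<^sup>+ u \<in> {0..}. ennreal (exp (- lam * (A (t + u) - A t))) \<partial>lborel)
        = ennreal (exp (lam * A t) * (T - H t))"
proof -
  define r where "r = exp (- lam * \<sigma>)"
  have r: "0 < r" "r < 1"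
    using assms by (auto simp: r_def)
  have "continuous_on UNIV (\<lambda>t. exp (- lam * A t))"
    by (intro continuous_intros cont)
  then obtain H0 where H0: "\<And>t. (H0 has_real_derivative exp (- lam * A t)) (at t)"
    using antiderivative_real_line by blast
  define H where "H = (\<lambda>t. H0 t - H0 0)"
  have H: "(H has_real_derivative exp (- lam * A t)) (at t)" for t
    unfolding H_def by (auto intro!: derivative_eq_intros H0)
  have H_0: "H 0 = 0"
    by (simp add: H_def)
  have H_less: "H s < H t" if "s < t" for s t
    by (rule DERIV_pos_imp_increasing[OF that]) (use H in \<open>auto intro!: exI[of _ "exp (- lam * A _)"]\<close>)
  have H_step: "H (t + c) = H c + r * H t" if "t \<ge> 0" for t
  proof (cases "t = 0")
    case False
    then have "t > 0" using that by simp
    have der: "((\<lambda>w. H (w + c) - r * H w) has_real_derivative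
        exp (- lam * A (w + c)) - r * exp (- lam * A w)) (at w)" for w
      using H[of "w + c"] by (intro DERIV_diff DERIV_cmult H) (simp add: DERIV_shift)
    have "H (t + c) - r * H t = H (0 + c) - r * H 0"
    proof (rule DERIV_isconst2[OF \<open>t > 0\<close>])
      show "continuous_on {0..t} (\<lambda>w. H (w + c) - r * H w)"
        using der DERIV_isCont by (blast intro: continuous_at_imp_continuous_on)
      fix w assume "0 < w" "w < t"
      then have "exp (- lam * A (w + c)) - r * exp (- lam * A w) = 0"
        by (simp add: periodic r_def distrib_left flip: exp_add)
      then show "((\<lambda>w. H (w + c) - r * H w) has_real_derivative 0) (at w)"
        using der[of w] by simp
    qed (use \<open>t > 0\<close> in auto)
    then show ?thesis by (simp add: H_0)
  qed (simp add: H_0)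
  define T where "T = H c / (1 - r)"
  have T: "H c = T - r * T"
  proof -
    have "T * (1 - r) = H c"
      using r by (simp add: T_def)
    then show ?thesis by (simp add: algebra_simps)
  qed
  have H_mult: "H (real k * c) = T - T * r ^ k" for k
  proof (induction k)
    case (Suc k)
    have "H (real (Suc k) * c) = H (real k * c + c)"
      by (simp add: algebra_simps)
    also have "\<dots> = H c + r * H (real k * c)"
      using \<open>c > 0\<close> by (intro H_step) simp
    also have "\<dots> = T - T * r ^ Suc k"
      unfolding Suc T by (simp add: algebra_simps)
    finally show ?case .
  qed (simp add: H_0)
  have T_pos: "T > 0"
    using H_less[of 0 c] \<open>c > 0\<close> r by (simp add: T_def H_0)
  have H_less_T: "H t < T" for t
  proof -
    obtain k :: nat where "t / c < real k"
      using reals_Archimedean2 by blast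
    then have "t < real k * c"
      using \<open>c > 0\<close> by (simp add: field_simps)
    from H_less[OF this] show ?thesis
      unfolding H_mult using T_pos r zero_less_power[of r k] mult_pos_pos[of T "r ^ k"] by linarith
  qed
  have "((\<lambda>k. T - T * r ^ k) \<longlongrightarrow> T - T * 0) sequentially"
    using r by (intro tendsto_intros LIMSEQ_power_zero) auto
  then have lim_mult: "(\<lambda>k. H (real k * c)) \<longlonglongrightarrow> T"
    by (simp add: H_mult)
  have lim: "(H \<longlongrightarrow> T) at_top"
  proof (rule order_tendstoI)
    fix a assume "a < T"
    then have "eventually (\<lambda>k. a < H (real k * c)) sequentially"
      by (rule order_tendstoD(1)[OF lim_mult])
    then obtain k where k: "a < H (real k * c)"
      by (auto dest: eventually_happens)
    show "eventually (\<lambda>t. a < H t) at_top"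
      using eventually_gt_at_top[of "real k * c"]
    proof eventually_elim
      case (elim t)
      then show ?case using H_less k by force
    qed
  qed (use H_less_T in \<open>auto intro: always_eventually less_trans\<close>)
  show ?thesis
  proof (rule that[of H T])
    show "T - H c = exp (- lam * \<sigma>) * (T - H 0)"
      by (simp add: T H_0 r_def)
    fix t :: real
    assume "t \<ge> 0"
    have "(\<integral>\<^sup>+ u. ennreal (exp (- lam * (A (t + u) - A t))) * indicator {0..} u \<partial>lborel)
        = ennreal (exp (lam * A t) * T - exp (lam * A t) * H (t + 0))"
    proof (rule nn_integral_FTC_atLeast)
      show "(\<lambda>u. exp (- lam * (A (t + u) - A t))) \<in> borel_measurable borel"
        by (intro borel_measurable_continuous_onI continuous_intros
            continuous_on_compose2[OF cont]) auto
      show "((\<lambda>u. exp (lam * A t) * H (t + u)) has_real_derivative exp (- lam * (A (t + u) - A t))) (at u)" for u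
      proof -
        have "((\<lambda>u. exp (lam * A t) * H (t + u)) has_real_derivative
            exp (lam * A t) * exp (- lam * A (t + u))) (at u)"
          using H[of "u + t"] DERIV_shift[of H _ u t] by (intro DERIV_cmult) (simp add: add.commute)
        then show ?thesis
          by (simp add: algebra_simps flip: exp_add)
      qed
      have "filterlim (\<lambda>u. t + u) at_top at_top"
        by (intro filterlim_tendsto_add_at_top[OF tendsto_const] filterlim_ident)
      then show "((\<lambda>u. exp (lam * A t) * H (t + u)) \<longlongrightarrow> exp (lam * A t) * T) at_top"
        by (intro tendsto_mult tendsto_const filterlim_compose[OF lim])
    qed auto
    then show "(\<integral>\<^sup>+ u \<in> {0..}. ennreal (exp (- lam * (A (t + u) - A t))) \<partial>lborel)
        = ennreal (exp (lam * A t) * (T - H t))"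
      by (simp add: algebra_simps)
  qed (use H H_less_T in auto)
qed

text \<open>While the location is not searched, \<open>A\<close> is constant, so the remaining time \<open>h\<close> decreases with slope
\<open>-1\<close>. The integral over the gap is needed for the average over all arrival times.\<close>
lemma remaining_time_gap:
  fixes A H :: "real \<Rightarrow> real" and lam T :: real
  defines "h \<equiv> \<lambda>t. exp (lam * A t) * (T - H t)"
  assumes H: "\<And>t. (H has_real_derivative exp (- lam * A t)) (at t)"
    and "a \<le> b" and A: "\<And>t. t \<in> {a..b} \<Longrightarrow> A t = A b"
  shows "h a = h b + (b - a)"
    and "(h has_integral (b - a)\<^sup>2 / 2 + (b - a) * h b) {a..b}"
proof -
  have cont: "continuous_on S H" for S
    using H DERIV_isCont by (blast intro: continuous_at_imp_continuous_on)
  have h: "h t = h b + (b - t)" if "t \<in> {a..b}" for t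
  proof (cases "t = b")
    case False
    then have "t < b" using that by simp
    have "H b - exp (- lam * A b) * b = H t - exp (- lam * A b) * t"
    proof (rule DERIV_isconst2[OF \<open>t < b\<close>])
      show "continuous_on {t..b} (\<lambda>w. H w - exp (- lam * A b) * w)"
        by (intro continuous_intros cont)
      fix w assume "t < w" "w < b"
      then show "((\<lambda>w. H w - exp (- lam * A b) * w) has_real_derivative 0) (at w)"
        using A[of w] that by (auto intro!: derivative_eq_intros H)
    qed (use \<open>t < b\<close> in auto)
    then have Ht: "H t = H b - exp (- lam * A b) * (b - t)"
      by (simp add: algebra_simps)
    have "exp (lam * A b) * exp (- lam * A b) = 1"
      by (simp flip: exp_add)
    then have "exp (lam * A b) * (T - (H b - exp (- lam * A b) * (b - t)))
        = exp (lam * A b) * (T - H b) + (b - t)"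
      by (simp add: right_diff_distrib mult.assoc[symmetric])
    then show ?thesis
      unfolding h_def A[OF that] Ht .
  qed simp
  show "h a = h b + (b - a)"
    using h[of a] \<open>a \<le> b\<close> by simp
  have "((\<lambda>t. h b + (b - t)) has_integral
      (h b * b - (b - b)\<^sup>2 / 2) - (h b * a - (b - a)\<^sup>2 / 2)) {a..b}"
    using \<open>a \<le> b\<close>
    by (intro fundamental_theorem_of_calculus)
      (auto intro!: derivative_eq_intros simp: field_simps
        simp flip: has_real_derivative_iff_has_vector_derivative)
  then have "((\<lambda>t. h b + (b - t)) has_integral (b - a)\<^sup>2 / 2 + (b - a) * h b) {a..b}"
    by (simp add: algebra_simps)
  then show "(h has_integral (b - a)\<^sup>2 / 2 + (b - a) * h b) {a..b}"
    by (rule has_integral_eq[rotated]) (rule h[symmetric])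
qed

text \<open>During a search \<open>h\<close> obeys \<open>h' = lam * h - 1\<close>. The equilibrium of this equation is \<open>1 / lam\<close>, the
expected detection time under uninterrupted search, and the deviation of \<open>h\<close> from it decays
exponentially backwards in time.\<close>
lemma remaining_time_search:
  fixes A H :: "real \<Rightarrow> real" and lam T :: real
  defines "h \<equiv> \<lambda>t. exp (lam * A t) * (T - H t)"
  assumes H: "\<And>t. (H has_real_derivative exp (- lam * A t)) (at t)"
    and "lam > 0" "a \<le> b" and A: "\<And>t. t \<in> {a..b} \<Longrightarrow> A t = A b - (b - t)"
  shows "h a = 1 / lam + exp (- lam * (b - a)) * (h b - 1 / lam)"
    and "(h has_integral (b - a) / lam + (1 - exp (- lam * (b - a))) / lam * (h b - 1 / lam)) {a..b}"
proof -
  have cont: "continuous_on S H" for S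
    using H DERIV_isCont by (blast intro: continuous_at_imp_continuous_on)
  have h: "h t = 1 / lam + exp (- lam * (b - t)) * (h b - 1 / lam)" if "t \<in> {a..b}" for t
  proof (cases "t = b")
    case False
    then have "t < b" using that by simp
    have "H b + exp (- lam * (A b - (b - b))) / lam = H t + exp (- lam * (A b - (b - t))) / lam"
    proof (rule DERIV_isconst2[OF \<open>t < b\<close>])
      show "continuous_on {t..b} (\<lambda>w. H w + exp (- lam * (A b - (b - w))) / lam)"
        using \<open>lam > 0\<close> by (intro continuous_intros cont) auto
      fix w assume "t < w" "w < b"
      then show "((\<lambda>w. H w + exp (- lam * (A b - (b - w))) / lam) has_real_derivative 0) (at w)"
        using A[of w] that \<open>lam > 0\<close> by (auto intro!: derivative_eq_intros H)
    qed (use \<open>t < b\<close> in auto)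
    then have "T - H t = T - H b + (exp (- lam * (A b - (b - t))) - exp (- lam * A b)) / lam"
      by (simp add: diff_divide_distrib)
    also have "exp (lam * A t) * \<dots> = exp (lam * A t) * exp (- lam * A b) * (exp (lam * A b) * (T - H b))
       + (exp (lam * A t) * exp (- lam * (A b - (b - t))) - exp (lam * A t) * exp (- lam * A b)) / lam"
      by (simp add: algebra_simps add_divide_distrib diff_divide_distrib flip: exp_add)
    also have "exp (lam * A t) * exp (- lam * (A b - (b - t))) = 1"
      unfolding A[OF that] by (simp flip: exp_add)
    also have "exp (lam * A t) * exp (- lam * A b) = exp (- lam * (b - t))"
      unfolding A[OF that] by (simp add: algebra_simps flip: exp_add)
    finally show ?thesis
      by (simp add: h_def algebra_simps diff_divide_distrib)
  qed simp
  show "h a = 1 / lam + exp (- lam * (b - a)) * (h b - 1 / lam)"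
    using h[of a] \<open>a \<le> b\<close> by simp
  have "((\<lambda>t. 1 / lam + exp (- lam * (b - t)) * (h b - 1 / lam)) has_integral
      (b / lam + exp (- lam * (b - b)) / lam * (h b - 1 / lam))
      - (a / lam + exp (- lam * (b - a)) / lam * (h b - 1 / lam))) {a..b}"
    using \<open>a \<le> b\<close> \<open>lam > 0\<close>
    by (intro fundamental_theorem_of_calculus)
      (auto intro!: derivative_eq_intros simp flip: has_real_derivative_iff_has_vector_derivative)
  then have "((\<lambda>t. 1 / lam + exp (- lam * (b - t)) * (h b - 1 / lam)) has_integral
      (b - a) / lam + (1 - exp (- lam * (b - a))) / lam * (h b - 1 / lam)) {a..b}"
    by (simp add: algebra_simps diff_divide_distrib add_divide_distrib)
  then show "(h has_integral (b - a) / lam + (1 - exp (- lam * (b - a))) / lam * (h b - 1 / lam)) {a..b}"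
    by (rule has_integral_eq[rotated]) (rule h[symmetric])
qed

section \<open>The mean detection time of a location searched twice per cycle\<close>

text \<open>The mean detection time at a location searched twice per cycle of length \<open>c\<close>, for \<open>x / 2\<close> each time,
where \<open>Q\<close> is the product of the two gaps between the searches. Splitting the total gap \<open>c - x\<close> is
rewarded by the term with \<open>Q\<close>; for \<open>Q = 0\<close> the two searches merge into a single one of length \<open>x\<close>.\<close>
definition mean_time :: "real \<Rightarrow> real \<Rightarrow> real \<Rightarrow> real \<Rightarrow> real" where
  "mean_time lam c x Q =
     ((2 * c - x) / lam + (c - x)\<^sup>2 / (2 * tanh (lam * x / 2)) - Q * tanh (lam * x / 4)) / c"

lemma half_tanh: "tanh (z / 2) = (1 - exp (- z)) / (1 + exp (- z))" for z :: real
  by (simp add: tanh_real_altdef)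

text \<open>The values \<open>w0, \<dots>, w4\<close> of the remaining time at the start of the cycle and at the starts and ends of
the two searches form a cyclic linear system, in which \<open>g0\<close> and \<open>g3\<close> are the two parts of the gap
that contains the end of the cycle, and \<open>r\<close> is the probability to survive one of the two searches.
Substituting its solution into the sum of the five integrals over the pieces of the cycle leaves
an expression in the total gap and the product of the two gaps only.\<close>
lemma two_gap_cycle_total:
  fixes r g1 g2 w0 w1 w2 w3 w4 :: real
  assumes "0 < r" "r < 1"
    and w0: "w0 = w1 + g0" and w1: "w1 = 1 / lam + r * (w2 - 1 / lam)"
    and w2: "w2 = w3 + g1" and w3: "w3 = 1 / lam + r * (w4 - 1 / lam)"
    and w4: "w4 = w0 + g3"
  shows "g0\<^sup>2 / 2 + g0 * w1 + (y / lam + (1 - r) / lam * (w2 - 1 / lam)) + (g1\<^sup>2 / 2 + g1 * w3)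
     + (y / lam + (1 - r) / lam * (w4 - 1 / lam)) + (g3\<^sup>2 / 2 + g3 * w0)
   = (2 * y + 2 * (g0 + g1 + g3)) / lam
     + (g0 + g1 + g3)\<^sup>2 / 2 * ((1 + r\<^sup>2) / (1 - r\<^sup>2)) - g1 * (g0 + g3) * ((1 - r) / (1 + r))"
proof -
  define G where "G = g0 + g3"
  define m where "m = 1 / lam"
  \<comment> \<open>The solution is simplest for the deviations from the equilibrium value \<open>1 / lam\<close> at the
    starts of the two searches.\<close>
  define a where "a = w1 - m"
  define b where "b = w3 - m"
  have r2: "1 - r\<^sup>2 \<noteq> 0" "1 + r \<noteq> 0"
    using assms(1,2) power2_eq_1_iff[of r] by auto
  have a: "a = r * (b + g1)"
    unfolding a_def b_def by (subst w1, subst w2) (simp add: m_def)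
  have b: "b = r * (a + G)"
    unfolding a_def b_def by (subst w3, subst w4, subst w0) (simp add: m_def G_def)
  have "a = r * (r * (a + G) + g1)"
    by (subst b[symmetric]) (rule a)
  then have "a * (1 - r\<^sup>2) = r * g1 + r\<^sup>2 * G"
    by (simp add: algebra_simps power2_eq_square)
  then have a': "a = (r * g1 + r\<^sup>2 * G) / (1 - r\<^sup>2)"
    using r2 by (simp add: nonzero_eq_divide_eq)
  have "b = r * (r * (b + g1) + G)"
    by (subst a[symmetric]) (rule b)
  then have "b * (1 - r\<^sup>2) = r * G + r\<^sup>2 * g1"
    by (simp add: algebra_simps power2_eq_square)
  then have b': "b = (r * G + r\<^sup>2 * g1) / (1 - r\<^sup>2)"
    using r2 by (simp add: nonzero_eq_divide_eq)
  have sum: "(1 - r) * (b + g1 + a + G) = G + g1"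
  proof -
    have "a + b = r * (b + g1 + a + G)"
      using a b by (simp add: algebra_simps)
    then show ?thesis by (simp add: algebra_simps)
  qed
  have sums: "g0 + g1 + g3 = G + g1" "g0 + g3 = G"
    by (auto simp: G_def)
  have w13: "w1 = a + m" "w3 = b + m"
    by (auto simp: a_def b_def)
  have w24: "w2 - m = b + g1" "w4 - m = a + G"
    using w2 w4 w0 w13 by (auto simp: G_def)
  have w0': "w0 = a + m + g0"
    using w0 w13 by simp
  have "g0\<^sup>2 / 2 + g0 * w1 + (y / lam + (1 - r) / lam * (w2 - 1 / lam)) + (g1\<^sup>2 / 2 + g1 * w3)
     + (y / lam + (1 - r) / lam * (w4 - 1 / lam)) + (g3\<^sup>2 / 2 + g3 * w0)
    = G\<^sup>2 / 2 + g1\<^sup>2 / 2 + G * (a + m) + g1 * (b + m) + 2 * y * m + m * ((1 - r) * (b + g1 + a + G))"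
  proof -
    have m: "z / lam = z * m" for z
      by (simp add: m_def)
    show ?thesis
      unfolding m_def[symmetric] w24 w13 w0' G_def
      by (simp add: m power2_eq_square algebra_simps add_divide_distrib)
  qed
  also have "\<dots> = (2 * y + 2 * (G + g1)) * m + (G\<^sup>2 / 2 + g1\<^sup>2 / 2 + G * a + g1 * b)"
    unfolding sum by (simp add: algebra_simps)
  also have "G\<^sup>2 / 2 + g1\<^sup>2 / 2 + G * a + g1 * b
      = (G + g1)\<^sup>2 / 2 * ((1 + r\<^sup>2) / (1 - r\<^sup>2)) - g1 * G * ((1 - r) / (1 + r))"
  proof -
    have e1: "(1 - r) / (1 + r) = (1 - r)\<^sup>2 / (1 - r\<^sup>2)"
      using r2 by (simp add: frac_eq_eq) (simp add: power2_eq_square algebra_simps)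
    have e2: "G\<^sup>2 / 2 + g1\<^sup>2 / 2 = (G\<^sup>2 / 2 + g1\<^sup>2 / 2) * (1 - r\<^sup>2) / (1 - r\<^sup>2)"
      using r2 by simp
    have e3: "(G\<^sup>2 / 2 + g1\<^sup>2 / 2) * (1 - r\<^sup>2) + G * (r * g1 + r\<^sup>2 * G) + g1 * (r * G + r\<^sup>2 * g1)
        = (G + g1)\<^sup>2 / 2 * (1 + r\<^sup>2) - g1 * G * (1 - r)\<^sup>2"
      by (simp add: power2_eq_square field_simps)
    have frac: "x + G * (k / D) + g1 * (l / D) = (z + G * k + g1 * l) / D" if "x = z / D" for x z k l D
      using that by (simp add: add_divide_distrib)
    show ?thesis
      unfolding a' b' e1 frac[OF e2] e3 by (simp only: diff_divide_distrib times_divide_eq_right)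
  qed
  finally show ?thesis
    unfolding sums m_def by (simp only: times_divide_eq_right mult_1_right)
qed

text \<open>The cycle consists of five pieces, three gaps and two searches, on which the remaining time and its
integral are explicit; the value at the end of the last piece equals that at the beginning of the
first, which closes the system of equations.\<close>
lemma mean_detection_of_survival:
  fixes A :: "real \<Rightarrow> real"
  assumes "lam > 0" "y > 0" "0 \<le> s1" "s1 + y \<le> s2" "s2 + y \<le> c"
    and cont: "continuous_on UNIV A"
    and periodic: "\<And>t. t \<ge> 0 \<Longrightarrow> A (t + c) = A t + 2 * y"
    and A0: "\<And>t. t \<in> {0..s1} \<Longrightarrow> A t = 0"
    and A1: "\<And>t. t \<in> {s1..s1 + y} \<Longrightarrow> A t = t - s1"
    and A2: "\<And>t. t \<in> {s1 + y..s2} \<Longrightarrow> A t = y"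
    and A3: "\<And>t. t \<in> {s2..s2 + y} \<Longrightarrow> A t = y + (t - s2)"
    and A4: "\<And>t. t \<in> {s2 + y..c} \<Longrightarrow> A t = 2 * y"
  shows "(\<integral>\<^sup>+ t \<in> {0..c}. (\<integral>\<^sup>+ u \<in> {0..}. ennreal (exp (- lam * (A (t + u) - A t))) \<partial>lborel) \<partial>lborel)
      / ennreal c = ennreal (mean_time lam c (2 * y) ((s2 - s1 - y) * (c - y - (s2 - s1))))"
proof -
  have "c > 0" "2 * y > 0"
    using assms(2-5) by auto
  obtain T H where H: "\<And>t. (H has_real_derivative exp (- lam * A t)) (at t)"
    and H_less: "\<And>t. H t < T"
    and T: "T - H c = exp (- lam * (2 * y)) * (T - H 0)"
    and inner: "\<And>t. t \<ge> 0 \<Longrightarrow> (\<integral>\<^sup>+ u \<in> {0..}. ennreal (exp (- lam * (A (t + u) - A t))) \<partial>lborel)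
        = ennreal (exp (lam * A t) * (T - H t))"
    by (rule survival_integral_periodic[where A = A and c = c and \<sigma> = "2 * y",
        OF \<open>lam > 0\<close> \<open>2 * y > 0\<close> \<open>c > 0\<close> cont]) (erule periodic, rule that)
  define h where "h = (\<lambda>t. exp (lam * A t) * (T - H t))"
  define r where "r = exp (- lam * y)"
  have r: "0 < r" "r < 1"
    using assms by (auto simp: r_def)
  have "A 0 = 0" "A c = 2 * y"
    using A0[of 0] A4[of c] assms by auto
  then have h_c: "h c = h 0"
    by (simp add: h_def T mult.assoc[symmetric] flip: exp_add)
  have h: "exp (lam * A t) * (T - H t) = h t" for t
    by (simp add: h_def)
  note gap = remaining_time_gap[OF H, where T = T, unfolded h]
  note search = remaining_time_search[OF H \<open>lam > 0\<close>, where T = T, unfolded h]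
  have p0: "A t = A s1" if "t \<in> {0..s1}" for t
    using A0 that by auto
  have p1: "A t = A (s1 + y) - ((s1 + y) - t)" if "t \<in> {s1..s1 + y}" for t
    using A1 that by auto
  have p2: "A t = A s2" if "t \<in> {s1 + y..s2}" for t
    using A2 that by auto
  have p3: "A t = A (s2 + y) - ((s2 + y) - t)" if "t \<in> {s2..s2 + y}" for t
    using A3 that by auto
  have p4: "A t = A c" if "t \<in> {s2 + y..c}" for t
    using A4 that by auto
  have y: "s1 \<le> s1 + y" "s2 \<le> s2 + y"
    using \<open>y > 0\<close> by auto
  note pieces = gap[OF assms(3) p0] search[OF y(1) p1] gap[OF assms(4) p2]
    search[OF y(2) p3] gap[OF assms(5) p4]
  define I where "I = (2 * y + 2 * (s1 + (s2 - s1 - y) + (c - s2 - y))) / lam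
     + (s1 + (s2 - s1 - y) + (c - s2 - y))\<^sup>2 / 2 * ((1 + r\<^sup>2) / (1 - r\<^sup>2))
     - (s2 - s1 - y) * (s1 + (c - s2 - y)) * ((1 - r) / (1 + r))"
  have "(h has_integral (s1\<^sup>2 / 2 + s1 * h s1 + (y / lam + (1 - r) / lam * (h (s1 + y) - 1 / lam))
     + ((s2 - s1 - y)\<^sup>2 / 2 + (s2 - s1 - y) * h s2)
     + (y / lam + (1 - r) / lam * (h (s2 + y) - 1 / lam)) + ((c - s2 - y)\<^sup>2 / 2 + (c - s2 - y) * h 0))) {0..c}"
  proof -
    have i0: "(h has_integral s1\<^sup>2 / 2 + s1 * h s1) {0..s1}"
      using pieces(2) by simp
    have i1: "(h has_integral y / lam + (1 - r) / lam * (h (s1 + y) - 1 / lam)) {s1..s1 + y}"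
      using pieces(4) by (simp add: r_def)
    have i2: "(h has_integral (s2 - s1 - y)\<^sup>2 / 2 + (s2 - s1 - y) * h s2) {s1 + y..s2}"
      using pieces(6) by (simp add: diff_diff_eq)
    have i3: "(h has_integral y / lam + (1 - r) / lam * (h (s2 + y) - 1 / lam)) {s2..s2 + y}"
      using pieces(8) by (simp add: r_def)
    have i4: "(h has_integral (c - s2 - y)\<^sup>2 / 2 + (c - s2 - y) * h 0) {s2 + y..c}"
      using pieces(10) by (simp add: diff_diff_eq h_c)
    note combine = has_integral_combine[where f = h and a = 0]
    have j1: "(h has_integral s1\<^sup>2 / 2 + s1 * h s1 + (y / lam + (1 - r) / lam * (h (s1 + y) - 1 / lam))) {0..s1 + y}"
      using assms(2-5) by (intro combine[OF _ _ i0 i1]) auto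
    note j2 = combine[OF _ _ j1 i2]
    note j3 = combine[OF _ _ j2 i3]
    note j4 = combine[OF _ _ j3 i4]
    show ?thesis
      using assms(2-5) by (intro j4) auto
  qed
  also have "s1\<^sup>2 / 2 + s1 * h s1 + (y / lam + (1 - r) / lam * (h (s1 + y) - 1 / lam))
     + ((s2 - s1 - y)\<^sup>2 / 2 + (s2 - s1 - y) * h s2)
     + (y / lam + (1 - r) / lam * (h (s2 + y) - 1 / lam)) + ((c - s2 - y)\<^sup>2 / 2 + (c - s2 - y) * h 0) = I"
    unfolding I_def
    by (rule two_gap_cycle_total[OF r])
      (use pieces(1,3,5,7,9) in \<open>auto simp: r_def h_c\<close>)
  finally have "(h has_integral I) {0..c}" .
  then have "((\<lambda>t. if t \<in> {0..c} then h t else 0) has_integral I) UNIV"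
    by (simp only: has_integral_restrict_UNIV)
  moreover have "continuous_on UNIV H"
    using H DERIV_isCont by (blast intro: continuous_at_imp_continuous_on)
  then have "continuous_on UNIV h"
    unfolding h_def by (intro continuous_intros cont)
  then have "(\<lambda>t. if t \<in> {0..c} then h t else 0) \<in> borel_measurable borel"
    by (intro measurable_If_set borel_measurable_continuous_onI) auto
  ultimately have "(\<integral>\<^sup>+ t. ennreal (if t \<in> {0..c} then h t else 0) \<partial>lborel) = ennreal I"
    using H_less by (intro nn_integral_has_integral_lborel) (auto simp: h_def less_imp_le)
  also have "(\<integral>\<^sup>+ t. ennreal (if t \<in> {0..c} then h t else 0) \<partial>lborel)
      = (\<integral>\<^sup>+ t \<in> {0..c}. (\<integral>\<^sup>+ u \<in> {0..}. ennreal (exp (- lam * (A (t + u) - A t))) \<partial>lborel) \<partial>lborel)"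
  proof (intro nn_integral_cong)
    fix t
    show "ennreal (if t \<in> {0..c} then h t else 0)
      = (\<integral>\<^sup>+ u \<in> {0..}. ennreal (exp (- lam * (A (t + u) - A t))) \<partial>lborel) * indicator {0..c} t"
      using inner[of t] by (cases "t \<in> {0..c}") (auto simp: h_def)
  qed
  finally have total: "(\<integral>\<^sup>+ t \<in> {0..c}. (\<integral>\<^sup>+ u \<in> {0..}.
      ennreal (exp (- lam * (A (t + u) - A t))) \<partial>lborel) \<partial>lborel) = ennreal I" .
  have "I \<ge> 0"
    using H_less by (intro has_integral_nonneg[OF \<open>(h has_integral I) {0..c}\<close>]) (auto simp: h_def less_imp_le)
  then have "ennreal I / ennreal c = ennreal (I / c)"
    using \<open>c > 0\<close> by (intro divide_ennreal)
  also have "I / c = mean_time lam c (2 * y) ((s2 - s1 - y) * (c - y - (s2 - s1)))"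
  proof -
    have "r\<^sup>2 = exp (- (2 * lam * y))"
      by (simp add: r_def power2_eq_square flip: exp_add)
    then have coth: "(1 + r\<^sup>2) / (1 - r\<^sup>2) = 1 / tanh (lam * (2 * y) / 2)"
      using half_tanh[of "2 * lam * y"] by simp
    have tanh: "(1 - r) / (1 + r) = tanh (lam * (2 * y) / 4)"
      using half_tanh[of "lam * y"] by (simp add: r_def)
    have gaps: "s1 + (s2 - s1 - y) + (c - s2 - y) = c - 2 * y" "s1 + (c - s2 - y) = c - y - (s2 - s1)"
      by auto
    have "2 * y + 2 * (c - 2 * y) = 2 * c - 2 * y"
      by simp
    then show ?thesis
      unfolding I_def mean_time_def coth tanh gaps by simp
  qed
  finally show ?thesis
    unfolding total .
qed

section \<open>Periodic search times as a set of real numbers\<close>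

definition two_searches :: "real \<Rightarrow> real \<Rightarrow> real \<Rightarrow> real \<Rightarrow> real set" where
  "two_searches c s1 s2 y =
     (\<Union>r::nat. {real r * c + s1 ..< real r * c + s1 + y} \<union> {real r * c + s2 ..< real r * c + s2 + y})"

lemma two_searches_measurable [measurable]: "two_searches c s1 s2 y \<in> sets borel"
  unfolding two_searches_def by measurable

lemma two_searches_first_cycle:
  assumes "0 \<le> s1" "s1 \<le> s2" "0 \<le> c" "x < c"
  shows "x \<in> two_searches c s1 s2 y \<longleftrightarrow> x \<in> {s1..<s1 + y} \<or> x \<in> {s2..<s2 + y}"
proof
  assume "x \<in> two_searches c s1 s2 y"
  then obtain r :: nat where r: "x \<in> {real r * c + s1 ..< real r * c + s1 + y} \<union> {real r * c + s2 ..< real r * c + s2 + y}"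
    by (auto simp: two_searches_def)
  have "r = 0"
  proof (rule ccontr)
    assume "r \<noteq> 0"
    then have "1 * c \<le> real r * c"
      using \<open>0 \<le> c\<close> by (intro mult_right_mono) auto
    then show False
      using r assms by auto
  qed
  then show "x \<in> {s1..<s1 + y} \<or> x \<in> {s2..<s2 + y}"
    using r by simp
qed (auto simp: two_searches_def intro!: exI[of _ "0::nat"])

text \<open>Beyond the first cycle, the search times repeat those of the previous cycle; this gives the
periodicity of the amount of search.\<close>
lemma two_searches_translate:
  assumes "0 \<le> s1" "s1 \<le> s2" "s2 + y \<le> c" "0 \<le> c"
  shows "two_searches c s1 s2 y \<inter> {c..t + c} = (+) c ` (two_searches c s1 s2 y \<inter> {0..t})"
proof (intro equalityI subsetI)
  fix x assume x: "x \<in> two_searches c s1 s2 y \<inter> {c..t + c}"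
  then obtain r :: nat where r: "x \<in> {real r * c + s1 ..< real r * c + s1 + y} \<union> {real r * c + s2 ..< real r * c + s2 + y}"
    by (auto simp: two_searches_def)
  have "r \<noteq> 0"
    using r x assms by (intro notI) auto
  then obtain q where q: "r = Suc q"
    by (cases r) auto
  have "x - c \<in> two_searches c s1 s2 y"
    using r unfolding q two_searches_def by (auto simp: algebra_simps intro!: exI[of _ q])
  then have "x - c \<in> two_searches c s1 s2 y \<inter> {0..t}"
    using x by auto
  then show "x \<in> (+) c ` (two_searches c s1 s2 y \<inter> {0..t})"
    by (rule rev_image_eqI) simp
next
  fix x assume "x \<in> (+) c ` (two_searches c s1 s2 y \<inter> {0..t})"
  then obtain z where z: "x = c + z" "z \<in> two_searches c s1 s2 y" "0 \<le> z" "z \<le> t"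
    by auto
  then obtain r :: nat where "z \<in> {real r * c + s1 ..< real r * c + s1 + y} \<union> {real r * c + s2 ..< real r * c + s2 + y}"
    by (auto simp: two_searches_def)
  then have "x \<in> {real (Suc r) * c + s1 ..< real (Suc r) * c + s1 + y} \<union> {real (Suc r) * c + s2 ..< real (Suc r) * c + s2 + y}"
    using z by (auto simp: algebra_simps)
  then have "x \<in> two_searches c s1 s2 y"
    unfolding two_searches_def by blast
  then show "x \<in> two_searches c s1 s2 y \<inter> {c..t + c}"
    using z by auto
qed

definition searched :: "real set \<Rightarrow> real \<Rightarrow> real" where
  "searched S t = measure lborel (S \<inter> {0..t})"

lemma measure_Int_Icc_le:
  fixes S :: "real set"
  assumes [measurable]: "S \<in> sets borel" and "a \<le> b"
  shows "measure lborel (S \<inter> {a..b}) \<le> b - a"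
proof -
  have "measure lborel (S \<inter> {a..b}) \<le> measure lborel {a..b}"
    by (rule measure_mono_fmeasurable) (auto simp: fmeasurable_def emeasure_lborel_Icc_eq)
  then show ?thesis using \<open>a \<le> b\<close> by simp
qed

lemma fmeasurable_Int_Icc:
  fixes S :: "real set"
  assumes [measurable]: "S \<in> sets borel"
  shows "S \<inter> {a..b} \<in> fmeasurable lborel"
  by (rule fmeasurableI2[of "{a..b}"]) (auto simp: fmeasurable_def emeasure_lborel_Icc_eq)

text \<open>The overlap of the two intervals is at most the point \<open>s\<close>, a null set.\<close>
lemma searched_add:
  fixes S :: "real set"
  assumes [measurable]: "S \<in> sets borel" and "0 \<le> s" "s \<le> t"
  shows "searched S t = searched S s + measure lborel (S \<inter> {s..t})"
proof -
  have "S \<inter> {0..t} = (S \<inter> {0..s}) \<union> (S \<inter> {s..t})"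
    using assms by auto
  moreover have "measure lborel ((S \<inter> {0..s}) \<union> (S \<inter> {s..t}))
      = measure lborel (S \<inter> {0..s}) + measure lborel (S \<inter> {s..t})"
  proof (rule measure_Un_AE)
    show "AE x in lborel. x \<notin> S \<inter> {0..s} \<or> x \<notin> S \<inter> {s..t}"
      using AE_lborel_singleton[of s] by eventually_elim auto
  qed (use fmeasurable_Int_Icc[OF assms(1)] in auto)
  ultimately show ?thesis by (simp add: searched_def)
qed

text \<open>The amount of search cannot grow faster than time, so it is 1-Lipschitz. As it vanishes for
negative times, this holds on the whole line, so that the survival probability has an antiderivative
that is differentiable from both sides at time 0.\<close>
lemma continuous_on_searched:
  fixes S :: "real set"
  assumes [measurable]: "S \<in> sets borel"
  shows "continuous_on UNIV (searched S)"
proof -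
  have *: "searched S s \<le> searched S t \<and> searched S t \<le> searched S s + (t - s)" if "s \<le> t" for s t
  proof
    show "searched S s \<le> searched S t"
      unfolding searched_def using that
      by (intro measure_mono_fmeasurable fmeasurable_Int_Icc) auto
    have "searched S t \<le> measure lborel ((S \<inter> {0..s}) \<union> (S \<inter> {s..t}))"
      unfolding searched_def using that
      by (intro measure_mono_fmeasurable fmeasurable.Un fmeasurable_Int_Icc) auto
    also have "\<dots> \<le> searched S s + measure lborel (S \<inter> {s..t})"
      unfolding searched_def
      by (intro measure_Un_le) auto
    also have "\<dots> \<le> searched S s + (t - s)"
      using measure_Int_Icc_le[OF assms that] by simp
    finally show "searched S t \<le> searched S s + (t - s)" .
  qed
  have "1-lipschitz_on UNIV (searched S)"
  proof (rule lipschitz_onI)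
    fix s t show "dist (searched S s) (searched S t) \<le> 1 * dist s t"
      using *[of s t] *[of t s] by (cases "s \<le> t") (auto simp: dist_real_def)
  qed simp
  then show ?thesis
    by (rule lipschitz_on_continuous_on)
qed

lemma searched_gap:
  fixes S :: "real set"
  assumes [measurable]: "S \<in> sets borel" and "0 \<le> a" "a \<le> b" "\<And>x. a \<le> x \<Longrightarrow> x < b \<Longrightarrow> x \<notin> S"
  shows "searched S b = searched S a"
proof -
  have "S \<inter> {a..b} \<subseteq> {b}"
    using assms(4) by force
  then have "measure lborel (S \<inter> {a..b}) \<le> measure lborel {b}"
    by (intro measure_mono_fmeasurable) (auto simp: fmeasurable_def)
  then show ?thesis
    using searched_add[OF assms(1-3)] measure_nonneg[of lborel "S \<inter> {a..b}"] by simp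
qed

lemma searched_search:
  fixes S :: "real set"
  assumes [measurable]: "S \<in> sets borel" and "0 \<le> a" "a \<le> b" "\<And>x. a \<le> x \<Longrightarrow> x < b \<Longrightarrow> x \<in> S"
  shows "searched S b = searched S a + (b - a)"
proof -
  have "measure lborel {a..<b} \<le> measure lborel (S \<inter> {a..b})"
    using assms(4) by (intro measure_mono_fmeasurable fmeasurable_Int_Icc) auto
  then show ?thesis
    using searched_add[OF assms(1-3)] measure_Int_Icc_le[OF assms(1,3)] \<open>a \<le> b\<close> by simp
qed

lemma measure_lborel_translation:
  fixes S :: "real set"
  assumes [measurable]: "S \<in> sets borel"
  shows "measure lborel ((+) c ` S) = measure lborel S"
proof -
  have "(+) c ` S = (\<lambda>x. x - c) -` S"
    by (auto intro: image_eqI[of _ _ "_ - c"])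
  also have "\<dots> \<in> sets borel"
    using measurable_sets[of "\<lambda>x. x - c" borel borel S] by simp
  finally have "(+) c ` S \<in> sets borel" .
  then show ?thesis
    using measure_translation[of c S] by simp
qed

text \<open>This covers every location that occurs below: interior locations of a sweep cycle have two positive
gaps, the end locations have one gap of length zero, and a single search can be cut into two
halves without a gap between them.\<close>
lemma detection_time_two_searches:
  assumes "lam i > 0" "y > 0" "0 \<le> s1" "s1 + y \<le> s2" "s2 + y \<le> c"
    and c: "cycle_length d p = c"
    and S: "search_times d p i = two_searches c s1 s2 y"
  shows "detection_time d lam p i
    = ennreal (mean_time (lam i) c (2 * y) ((s2 - s1 - y) * (c - y - (s2 - s1))))"
proof -
  define S where "S = two_searches c s1 s2 y"
  have [measurable]: "S \<in> sets borel"
    by (simp add: S_def)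
  note meas = this
  have le: "0 \<le> s1" "s1 \<le> s2" "0 \<le> c"
    using assms(2-5) by auto
  have mem: "x \<in> S \<longleftrightarrow> x \<in> {s1..<s1 + y} \<or> x \<in> {s2..<s2 + y}" if "x < c" for x
    unfolding S_def by (rule two_searches_first_cycle[OF le that])
  have A_0: "searched S 0 = 0"
    using measure_Int_Icc_le[OF meas, of 0 0] measure_nonneg[of lborel "S \<inter> {0}"]
    by (simp add: searched_def)
  have A0: "searched S t = 0" if "t \<in> {0..s1}" for t
    using searched_gap[OF meas, of 0 t] that mem assms(2-5) A_0 by force
  have A1: "searched S t = t - s1" if "t \<in> {s1..s1 + y}" for t
    using searched_search[OF meas, of s1 t] that mem assms(2-5) A0[of s1] by force
  have A2: "searched S t = y" if "t \<in> {s1 + y..s2}" for t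
    using searched_gap[OF meas, of "s1 + y" t] that mem assms(2-5) A1[of "s1 + y"] by force
  have A3: "searched S t = y + (t - s2)" if "t \<in> {s2..s2 + y}" for t
    using searched_search[OF meas, of s2 t] that mem assms(2-5) A2[of s2] by force
  have A4: "searched S t = 2 * y" if "t \<in> {s2 + y..c}" for t
    using searched_gap[OF meas, of "s2 + y" t] that mem assms(2-5) A3[of "s2 + y"] by force
  have periodic: "searched S (t + c) = searched S t + 2 * y" if "t \<ge> 0" for t
  proof -
    have "searched S (t + c) = searched S c + measure lborel (S \<inter> {c..t + c})"
      using that le by (intro searched_add) auto
    also have "S \<inter> {c..t + c} = (+) c ` (S \<inter> {0..t})"
      unfolding S_def using le assms(5) by (intro two_searches_translate)
    also have "measure lborel \<dots> = searched S t"
      unfolding searched_def by (intro measure_lborel_translation) simp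
    finally show ?thesis
      using A4[of c] assms(5) by simp
  qed
  have amount: "search_amount d p i t (t + u) = searched S (t + u) - searched S t"
    if "t \<ge> 0" "u \<ge> 0" for t u
    using searched_add[OF meas, of t "t + u"] that
    by (simp add: search_amount_def S S_def)
  have inner: "(\<integral>\<^sup>+ u \<in> {0..}. ennreal (exp (- lam i * search_amount d p i t (t + u))) \<partial>lborel)
      = (\<integral>\<^sup>+ u \<in> {0..}. ennreal (exp (- lam i * (searched S (t + u) - searched S t))) \<partial>lborel)"
    if "t \<ge> 0" for t
    using that by (intro nn_integral_cong) (auto simp: amount indicator_def)
  have "(\<integral>\<^sup>+ t \<in> {0..c}. (\<integral>\<^sup>+ u \<in> {0..}. ennreal (exp (- lam i * search_amount d p i t (t + u))) \<partial>lborel) \<partial>lborel)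
      = (\<integral>\<^sup>+ t \<in> {0..c}. (\<integral>\<^sup>+ u \<in> {0..}. ennreal (exp (- lam i * (searched S (t + u) - searched S t))) \<partial>lborel) \<partial>lborel)"
  proof (intro nn_integral_cong)
    fix t
    show "(\<integral>\<^sup>+ u \<in> {0..}. ennreal (exp (- lam i * search_amount d p i t (t + u))) \<partial>lborel) * indicator {0..c} t
      = (\<integral>\<^sup>+ u \<in> {0..}. ennreal (exp (- lam i * (searched S (t + u) - searched S t))) \<partial>lborel) * indicator {0..c} t"
      using inner[of t] by (cases "t \<ge> 0") auto
  qed
  then show ?thesis
    unfolding detection_time_def c
    using mean_detection_of_survival[OF assms(1-5) continuous_on_searched[OF meas] periodic A0 A1 A2 A3 A4]
    by simp
qed

section \<open>Tours of a line network\<close>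

text \<open>The travel time of a sweep, which crosses each link once in each direction.\<close>
definition round_trip :: "nat \<Rightarrow> (nat \<Rightarrow> nat \<Rightarrow> real) \<Rightarrow> real" where
  "round_trip n d = (\<Sum>j=1..<n. d j (j + 1) + d (j + 1) j)"

lemma line_network_round_trip:
  assumes "line_network n d" "n \<ge> 2"
  shows "d 1 n + d n 1 = round_trip n d"
proof -
  have "1 \<in> {1..n}" "n \<in> {1..n}" "1 < n"
    using assms(2) by auto
  then have "d 1 n = (\<Sum>k=1..<n. d k (k + 1))" "d n 1 = (\<Sum>k=1+1..n. d k (k - 1))"
    using assms(1) unfolding line_network_def by blast+
  moreover have "(\<Sum>k=1+1..n. d k (k - 1)) = (\<Sum>k=1..<n. d (k + 1) k)"
    using assms(2) by (intro sum.reindex_bij_witness[of _ Suc "\<lambda>k. k - 1"]) auto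
  ultimately show ?thesis
    by (simp add: round_trip_def sum.distrib)
qed

lemma triangle_walk:
  fixes q :: "nat \<Rightarrow> nat"
  assumes "travel_times n d" "a \<le> b" "\<And>k. k \<in> {a..b} \<Longrightarrow> q k \<in> {1..n}"
  shows "d (q a) (q b) \<le> (\<Sum>k=a..<b. d (q k) (q (Suc k)))"
  using assms(2,3)
proof (induction b rule: dec_induct)
  case base
  then show ?case using assms(1) by (simp add: travel_times_def)
next
  case (step b)
  have "d (q a) (q (Suc b)) \<le> d (q a) (q b) + d (q b) (q (Suc b))"
    using assms(1) step unfolding travel_times_def by force
  also have "d (q a) (q b) \<le> (\<Sum>k=a..<b. d (q k) (q (Suc k)))"
    using step by simp
  finally show ?case
    using step by simp
qed

text \<open>A closed walk that meets two positions \<open>a\<close> and \<open>b\<close> travels from one to the other and back, the return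
possibly passing through the seam at which the cycle closes.\<close>
lemma triangle_closed_walk:
  fixes q :: "nat \<Rightarrow> nat"
  assumes "travel_times n d" "a \<le> b" "b \<le> m" "\<And>k. k \<le> m \<Longrightarrow> q k \<in> {1..n}" "q m = q 0"
  shows "d (q a) (q b) + d (q b) (q a) \<le> (\<Sum>k<m. d (q k) (q (Suc k)))"
proof -
  have "d (q b) (q a) \<le> d (q b) (q m) + d (q 0) (q a)"
    using assms unfolding travel_times_def by simp
  moreover have "d (q 0) (q a) \<le> (\<Sum>k=0..<a. d (q k) (q (Suc k)))"
    "d (q a) (q b) \<le> (\<Sum>k=a..<b. d (q k) (q (Suc k)))"
    "d (q b) (q m) \<le> (\<Sum>k=b..<m. d (q k) (q (Suc k)))"
    by (rule triangle_walk[OF assms(1)]; use assms(2-4) in simp)+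
  moreover have "(\<Sum>k<m. d (q k) (q (Suc k))) = (\<Sum>k=0..<a. d (q k) (q (Suc k)))
      + (\<Sum>k=a..<b. d (q k) (q (Suc k))) + (\<Sum>k=b..<m. d (q k) (q (Suc k)))"
    using assms(2,3) by (simp add: lessThan_atLeast0 sum.atLeastLessThan_concat)
  ultimately show ?thesis by simp
qed

lemma start_time_0 [simp]: "start_time d p 0 = 0"
  by (simp add: start_time_def)

lemma start_time_Suc:
  "start_time d p (Suc k) =
    start_time d p k + snd (p ! k) + d (fst (p ! k)) (fst (p ! (Suc k mod length p)))"
  by (simp add: start_time_def)

lemma travel_times_nonneg:
  assumes "travel_times n d" "i \<in> {1..n}" "j \<in> {1..n}"
  shows "d i j \<ge> 0"
  using assms unfolding travel_times_def by (cases "i = j") (auto simp: less_imp_le)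

lemma start_time_step:
  assumes "travel_times n d" "fst ` set p \<subseteq> {1..n}" "k < length p"
  shows "start_time d p k + snd (p ! k) \<le> start_time d p (Suc k)"
proof -
  have "p ! k \<in> set p" "p ! (Suc k mod length p) \<in> set p"
    using assms(3) by (auto intro!: nth_mem mod_less_divisor)
  then have "fst (p ! k) \<in> {1..n}" "fst (p ! (Suc k mod length p)) \<in> {1..n}"
    using assms(2) by blast+
  from travel_times_nonneg[OF assms(1) this] show ?thesis
    by (simp add: start_time_Suc)
qed

lemma start_time_mono:
  assumes "travel_times n d" "fst ` set p \<subseteq> {1..n}" "\<And>e. e \<in> set p \<Longrightarrow> snd e \<ge> 0"
    and "k \<le> l" "l \<le> length p"
  shows "start_time d p k \<le> start_time d p l"
  using assms(4,5)
proof (induction l rule: dec_induct)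
  case (step l)
  then have "snd (p ! l) \<ge> 0"
    by (intro assms(3)) simp
  then show ?case
    using step start_time_step[OF assms(1,2), of l] by simp
qed simp

lemma start_time_search_le:
  assumes "travel_times n d" "fst ` set p \<subseteq> {1..n}" "\<And>e. e \<in> set p \<Longrightarrow> snd e \<ge> 0"
    and "k < l" "l \<le> length p"
  shows "start_time d p k + snd (p ! k) \<le> start_time d p l"
proof -
  have "start_time d p k + snd (p ! k) \<le> start_time d p (Suc k)"
    using assms by (intro start_time_step) auto
  also have "\<dots> \<le> start_time d p l"
    using assms by (intro start_time_mono) auto
  finally show ?thesis .
qed

text \<open>Every tour visits the two ends \<open>1\<close> and \<open>n\<close> of the line, and going from one to the other and back
already costs as much as a sweep.\<close>
lemma round_trip_le_tour:
  assumes "line_network n d" "n \<ge> 2" "set (map fst p) = {1..n}"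
  shows "round_trip n d \<le> (\<Sum>k<length p. d (fst (p ! k)) (fst (p ! (Suc k mod length p))))"
proof -
  define q where "q = (\<lambda>k. fst (p ! (k mod length p)))"
  have tt: "travel_times n d"
    using assms(1) by (simp add: line_network_def)
  have "p \<noteq> []"
    using assms(2,3) by auto
  have q: "q k \<in> {1..n}" for k
    using assms(3) \<open>p \<noteq> []\<close> nth_mem[of "k mod length p" p] by (auto simp: q_def)
  have visit: "\<exists>k<length p. q k = j" if "j \<in> {1..n}" for j
  proof -
    have "j \<in> set (map fst p)"
      unfolding assms(3) by (rule that)
    then obtain k where "k < length p" "fst (p ! k) = j"
      by (metis in_set_conv_nth length_map nth_map)
    then show ?thesis
      by (intro exI[of _ k]) (simp add: q_def)
  qed
  obtain a where a: "a < length p" "q a = 1"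
    using visit[of 1] assms(2) by force
  obtain b where b: "b < length p" "q b = n"
    using visit[of n] assms(2) by force
  have "q (length p) = q 0"
    by (simp add: q_def)
  then have walk: "d (q a) (q b) + d (q b) (q a) \<le> (\<Sum>k<length p. d (q k) (q (Suc k)))"
    if "a \<le> b" "b < length p" for a b
    using that q by (intro triangle_closed_walk[OF tt]) simp_all
  have "d 1 n + d n 1 \<le> (\<Sum>k<length p. d (q k) (q (Suc k)))"
  proof (cases "a \<le> b")
    case True
    then show ?thesis using walk[of a b] a b by simp
  next
    case False
    then show ?thesis using walk[of b a] a b by simp
  qed
  also have "\<dots> = (\<Sum>k<length p. d (fst (p ! k)) (fst (p ! (Suc k mod length p))))"
    by (intro sum.cong) (auto simp: q_def)
  finally show ?thesis
    using line_network_round_trip[OF assms(1,2)] by simp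
qed

section \<open>Detection times of simple cycles and of sweep cycles\<close>

lemma simple_cycle_detection_time:
  assumes "line_network n d" "n \<ge> 2" "p \<in> simple_cycles n"
    and lam: "\<And>i. i \<in> {1..n} \<Longrightarrow> lam i > 0"
  obtains x c where "\<And>i. i \<in> {1..n} \<Longrightarrow> x i > 0" "c \<ge> round_trip n d + (\<Sum>i=1..n. x i)"
    "\<And>i. i \<in> {1..n} \<Longrightarrow> detection_time d lam p i = ennreal (mean_time (lam i) c (x i) 0)"
proof -
  have p: "distinct (map fst p)" "set (map fst p) = {1..n}" "\<And>e. e \<in> set p \<Longrightarrow> snd e > 0"
    using assms(3) by (auto simp: simple_cycles_def)
  have tt: "travel_times n d"
    using assms(1) by (simp add: line_network_def)
  have snd_nonneg: "\<And>e. e \<in> set p \<Longrightarrow> snd e \<ge> 0"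
    using p(3) less_imp_le by blast
  have fst_p: "fst ` set p \<subseteq> {1..n}"
    using p(2) by simp
  define x where "x = (\<lambda>i. the (map_of p i))"
  define c where "c = cycle_length d p"
  have x: "snd (p ! k) = x (fst (p ! k))" if "k < length p" for k
    using that map_of_eq_Some_iff[OF p(1), of "fst (p ! k)" "snd (p ! k)"] by (simp add: x_def)
  have idx: "\<exists>k<length p. fst (p ! k) = i" if "i \<in> {1..n}" for i
    using that p(2) by (metis in_set_conv_nth length_map nth_map)
  have x_pos: "x i > 0" if "i \<in> {1..n}" for i
    using idx[OF that] x p(3) nth_mem by metis
  have "(\<Sum>k<length p. snd (p ! k)) = (\<Sum>k<length p. x (fst (p ! k)))"
    by (intro sum.cong) (auto simp: x)
  also have "\<dots> = sum_list (map x (map fst p))"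
    by (simp add: sum_list_sum_nth lessThan_atLeast0)
  also have "\<dots> = sum x {1..n}"
    using p(1,2) by (simp only: sum_list_distinct_conv_sum_set)
  finally have c: "c = sum x {1..n} + (\<Sum>k<length p. d (fst (p ! k)) (fst (p ! (Suc k mod length p))))"
    by (simp add: c_def cycle_length_def start_time_def sum.distrib)
  have "c \<ge> round_trip n d + (\<Sum>i=1..n. x i)"
    using round_trip_le_tour[OF assms(1,2) p(2)] c by simp
  moreover have "detection_time d lam p i = ennreal (mean_time (lam i) c (x i) 0)" if i: "i \<in> {1..n}" for i
  proof -
    obtain k where k: "k < length p" "fst (p ! k) = i"
      using idx[OF i] by blast
    have "{k'. k' < length p \<and> fst (p ! k') = i} = {k}"
      using k p(1) by (auto simp: distinct_conv_nth)
    then have "search_times d p i = (\<Union>r::nat. {real r * c + start_time d p k ..< real r * c + start_time d p k + x i})"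
      using x[of k] k by (simp add: search_times_def c_def)
    \<comment> \<open>Cut the only search into two halves; the gap between them is zero.\<close>
    also have "\<dots> = two_searches c (start_time d p k) (start_time d p k + x i / 2) (x i / 2)"
      unfolding two_searches_def using x_pos[OF i]
      by (intro arg_cong[where f = Union] image_cong refl) (auto simp: field_simps)
    finally have S: "search_times d p i = two_searches c (start_time d p k) (start_time d p k + x i / 2) (x i / 2)" .
    have "0 \<le> start_time d p k"
      using start_time_mono[OF tt fst_p snd_nonneg, of 0 k] k by simp
    moreover have "start_time d p k + x i \<le> c"
      using start_time_search_le[OF tt fst_p snd_nonneg, of k "length p"] k x[of k]
      by (simp add: c_def cycle_length_def)
    ultimately show ?thesis
      using detection_time_two_searches[where lam = lam and i = i, OF lam[OF i] _ _ _ _ c_def[symmetric] S] x_pos[OF i] by simp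
  qed
  ultimately show ?thesis
    by (intro that[of x c] x_pos)
qed

text \<open>The time between the second search at \<open>i\<close> and the first search at \<open>i\<close> in the next cycle, when a sweep
with total search times \<open>x\<close> visits \<open>i - 1, \<dots>, 1\<close> and returns through \<open>1, \<dots>, i - 1\<close>. It is empty for
\<open>i = 1\<close>.\<close>
definition return_gap :: "(nat \<Rightarrow> nat \<Rightarrow> real) \<Rightarrow> (nat \<Rightarrow> real) \<Rightarrow> nat \<Rightarrow> real" where
  "return_gap d x i = (\<Sum>j=1..<i. x j + d j (j + 1) + d (j + 1) j)"

text \<open>A sweep in which the total search time \<open>x i\<close> is divided equally between the two visits to \<open>i\<close>. Its
cycle length \<open>c\<close> is the least one that a simple cycle with the same search times can have.\<close>
lemma sweep_cycle_detection_time: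
  assumes "travel_times n d" "n \<ge> 1"
    and x: "\<And>i. i \<in> {1..n} \<Longrightarrow> x i > 0"
    and lam: "\<And>i. i \<in> {1..n} \<Longrightarrow> lam i > 0"
    and c: "c = round_trip n d + (\<Sum>i=1..n. x i)"
  obtains p where "p \<in> sweep_cycles n"
    "\<And>i. i \<in> {1..n} \<Longrightarrow> detection_time d lam p i
       = ennreal (mean_time (lam i) c (x i) (return_gap d x i * (c - x i - return_gap d x i)))"
proof -
  define ls where "ls = [1..<n + 1] @ rev [1..<n + 1]"
  define y where "y = (\<lambda>i. x i / 2)"
  define p where "p = map (\<lambda>i. (i, y i)) ls"
  have len [simp]: "length p = 2 * n"
    by (simp add: p_def ls_def)
  have set_ls: "set ls = {1..n}"
    by (auto simp: ls_def)
  have y: "y i > 0" if "i \<in> {1..n}" for i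
    using x[OF that] by (simp add: y_def)
  have len_ls: "length ls = 2 * n"
    by (simp add: ls_def)
  have "sweep_pattern n (map y ls) = zip ls (map y ls)"
    by (simp only: sweep_pattern_def ls_def)
  also have "\<dots> = p"
    by (simp add: p_def zip_map2 zip_same_conv_map)
  finally have "p \<in> sweep_cycles n"
    unfolding sweep_cycles_def mem_Collect_eq
    by (intro exI[of _ "map y ls"]) (use y set_ls len_ls in auto)
  have nth_ls: "ls ! k = (if k < n then k + 1 else 2 * n - k)" if "k < 2 * n" for k
    using that by (auto simp: ls_def nth_append rev_nth simp del: upt_Suc)
  have nth_p: "fst (p ! k) = ls ! k" "snd (p ! k) = y (ls ! k)" if "k < 2 * n" for k
    using that len_ls by (auto simp: p_def)
  have fst_p: "fst ` set p \<subseteq> {1..n}"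
    by (simp add: p_def image_image set_ls)
  have snd_nonneg: "snd e \<ge> 0" if e: "e \<in> set p" for e
  proof -
    obtain j where "j \<in> {1..n}" "e = (j, y j)"
      using e by (auto simp: p_def set_ls simp del: atLeastAtMost_iff)
    then show ?thesis
      using y[of j] by simp
  qed
  have d0: "d i i = 0" if "i \<in> {1..n}" for i
    using assms(1) that by (simp add: travel_times_def)
  define s1 where "s1 = (\<lambda>i. start_time d p (i - 1))"
  define s2 where "s2 = (\<lambda>i. start_time d p (2 * n - i))"
  define C where "C = cycle_length d p"
  have out: "p ! (i - 1) = (i, y i)" and ret: "p ! (2 * n - i) = (i, y i)" if "i \<in> {1..n}" for i
  proof -
    have "i - 1 < 2 * n" "i - 1 < n" "i - 1 + 1 = i" "2 * n - i < 2 * n" "\<not> 2 * n - i < n" "2 * n - (2 * n - i) = i"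
      using that by auto
    then show "p ! (i - 1) = (i, y i)" "p ! (2 * n - i) = (i, y i)"
      by (simp_all only: prod_eq_iff nth_p nth_ls if_True if_False fst_conv snd_conv simp_thms)
  qed
  \<comment> \<open>Moving from \<open>i\<close> to \<open>i + 1\<close> prolongs the excursion through the end of the cycle by the two
    searches at \<open>i\<close> and by the link between \<open>i\<close> and \<open>i + 1\<close> in both directions.\<close>
  have gap: "C - (s2 i + y i - s1 i) = return_gap d x i" if "1 \<le> i" "i \<le> n" for i
    using that
  proof (induction i rule: nat_induct_at_least)
    case base
    have "C = start_time d p (Suc (2 * n - 1))"
      using assms(2) by (simp add: C_def cycle_length_def)
    also have "\<dots> = s2 1 + y 1 + d 1 (fst (p ! (Suc (2 * n - 1) mod (2 * n))))"
      using ret[of 1] assms(2) by (simp only: start_time_Suc s2_def len) simp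
    also have "Suc (2 * n - 1) mod (2 * n) = 1 - 1"
      using assms(2) by simp
    also have "fst (p ! (1 - 1)) = 1"
      using out[of 1] assms(2) by simp
    finally show ?case
      using d0[of 1] assms(2) by (simp add: s1_def return_gap_def)
  next
    case (Suc i)
    have i: "i \<in> {1..n}" "Suc i \<in> {1..n}"
      using Suc by auto
    have "s1 (Suc i) = start_time d p (Suc (i - 1))"
      using i by (simp add: s1_def)
    also have "\<dots> = s1 i + y i + d i (fst (p ! (Suc (i - 1) mod (2 * n))))"
      using out[OF i(1)] by (simp only: start_time_Suc s1_def len fst_conv snd_conv)
    also have "Suc (i - 1) mod (2 * n) = Suc i - 1"
      using i by simp
    also have "fst (p ! (Suc i - 1)) = Suc i"
      using out[OF i(2)] by simp
    finally have 1: "s1 (Suc i) = s1 i + y i + d i (Suc i)" .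
    have "s2 i = start_time d p (Suc (2 * n - Suc i))"
      using i by (simp add: s2_def Suc_diff_Suc)
    also have "\<dots> = s2 (Suc i) + y (Suc i) + d (Suc i) (fst (p ! (Suc (2 * n - Suc i) mod (2 * n))))"
      using ret[OF i(2)] by (simp only: start_time_Suc s2_def len fst_conv snd_conv)
    also have "Suc (2 * n - Suc i) mod (2 * n) = 2 * n - i"
      using i by simp
    also have "fst (p ! (2 * n - i)) = i"
      using ret[OF i(1)] by simp
    finally show ?case
      using 1 Suc by (simp add: return_gap_def y_def)
  qed
  have n: "n \<in> {1..n}"
    using assms(2) by simp
  have "s2 n = start_time d p (Suc (n - 1))"
    using assms(2) by (simp add: s2_def mult_2)
  also have "\<dots> = s1 n + y n + d n (fst (p ! (Suc (n - 1) mod (2 * n))))"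
    using out[OF n] by (simp only: start_time_Suc s1_def len fst_conv snd_conv)
  also have "Suc (n - 1) mod (2 * n) = 2 * n - n"
    using assms(2) by simp
  also have "fst (p ! (2 * n - n)) = n"
    using ret[OF n] by simp
  finally have "s2 n = s1 n + y n"
    using d0[OF n] by simp
  then have "C = return_gap d x n + x n"
    using gap[of n] assms(2) by (simp add: y_def)
  also have "\<dots> = c"
    using assms(2) by (simp add: c return_gap_def round_trip_def sum.distrib sum.last_plus)
  finally have C: "cycle_length d p = c"
    by (simp add: C_def)
  have "detection_time d lam p i
       = ennreal (mean_time (lam i) c (x i) (return_gap d x i * (c - x i - return_gap d x i)))"
    if i: "i \<in> {1..n}" for i
  proof -
    have "{k. k < length p \<and> fst (p ! k) = i} = {i - 1, 2 * n - i}"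
      using i by (auto simp: nth_p nth_ls split: if_splits)
    then have S: "search_times d p i = two_searches c (s1 i) (s2 i) (y i)"
      by (simp add: search_times_def two_searches_def C s1_def s2_def out[OF i, simplified] ret[OF i])
    have order: "i - 1 \<le> 2 * n" "i - 1 < 2 * n - i" "2 * n - i < 2 * n"
      using i by auto
    have "0 \<le> s1 i"
      using start_time_mono[OF assms(1) fst_p snd_nonneg, of 0 "i - 1"] order by (simp add: s1_def)
    moreover have "s1 i + y i \<le> s2 i"
      using start_time_search_le[OF assms(1) fst_p snd_nonneg, of "i - 1" "2 * n - i"] order out[OF i]
      by (simp add: s1_def s2_def)
    moreover have "s2 i + y i \<le> c"
      using start_time_search_le[OF assms(1) fst_p snd_nonneg, of "2 * n - i" "2 * n"] order C ret[OF i]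
      by (simp add: s2_def cycle_length_def)
    ultimately have det: "detection_time d lam p i
        = ennreal (mean_time (lam i) c (2 * y i) ((s2 i - s1 i - y i) * (c - y i - (s2 i - s1 i))))"
      by (rule detection_time_two_searches[where lam = lam and i = i, OF lam[OF i] y[OF i] _ _ _ C S])
    have gaps: "s2 i - s1 i - y i = c - x i - return_gap d x i" "c - y i - (s2 i - s1 i) = return_gap d x i"
      using gap[of i] i C by (auto simp: y_def C_def)
    show ?thesis
      unfolding det gaps by (simp add: y_def mult.commute)
  qed
  then show ?thesis
    using \<open>p \<in> sweep_cycles n\<close> by (intro that[of p])
qed

section \<open>Dependence of the mean detection time on its parameters\<close>

text \<open>For fixed search time a longer cycle only adds gap. Writing the mean as a function of \<open>c\<close>, the terms
\<open>- x / c\<close> and \<open>(c - x)\<^sup>2 / c\<close> both increase, the former strictly.\<close>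
lemma mean_time_mono:
  assumes "lam > 0" "x > 0" "x \<le> c" "c \<le> c'"
  shows "mean_time lam c x 0 \<le> mean_time lam c' x 0"
    and "c < c' \<Longrightarrow> mean_time lam c x 0 < mean_time lam c' x 0"
proof -
  have pos: "c > 0" "c' > 0" "tanh (lam * x / 2) > 0"
    using assms by auto
  have eq: "mean_time lam e x 0 = 2 / lam - x / lam / e + (e - x)\<^sup>2 / e / (2 * tanh (lam * x / 2))"
    if "e > 0" for e
    using that by (simp add: mean_time_def add_divide_distrib diff_divide_distrib)
  have "(c' - x)\<^sup>2 / c' - (c - x)\<^sup>2 / c = (c' - c) * (c * c' - x * x) / (c * c')"
    using pos by (simp add: divide_simps) (simp add: algebra_simps power2_eq_square)
  moreover have "x * x \<le> c * c'"
    using assms by (intro mult_mono) auto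
  ultimately have "(c - x)\<^sup>2 / c \<le> (c' - x)\<^sup>2 / c'"
    using assms pos by (smt (verit) divide_nonneg_pos mult_nonneg_nonneg mult_pos_pos)
  then have *: "(c - x)\<^sup>2 / c / (2 * tanh (lam * x / 2)) \<le> (c' - x)\<^sup>2 / c' / (2 * tanh (lam * x / 2))"
    using pos by (intro divide_right_mono) auto
  have "x / lam / c' \<le> x / lam / c"
    using assms pos by (intro divide_left_mono) auto
  then show "mean_time lam c x 0 \<le> mean_time lam c' x 0"
    using * pos by (simp only: eq)
  assume "c < c'"
  then have "x / lam / c' < x / lam / c"
    using assms pos by (intro divide_strict_left_mono) auto
  then show "mean_time lam c x 0 < mean_time lam c' x 0"
    using * pos by (simp only: eq)
qed

text \<open>The first bound shows that long cycles are bad for a location that has at most half of the cycle, and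
the second that short searches are bad; they come from \<open>tanh z < 1\<close> and \<open>tanh (z / 2) \<le> z\<close>.\<close>
lemma mean_time_bounds:
  assumes "lam > 0" "x > 0" "x < c"
  shows "(c - x)\<^sup>2 / (2 * c) < mean_time lam c x 0"
    and "(c - x)\<^sup>2 / (2 * lam * x * c) < mean_time lam c x 0"
proof -
  define z where "z = lam * x"
  have z: "z > 0"
    using assms by (simp add: z_def)
  have pos: "tanh (z / 2) > 0"
    using z by simp
  have first: "(2 * c - x) / lam / c > 0"
    using assms by auto
  have eq: "mean_time lam c x 0 = (2 * c - x) / lam / c + (c - x)\<^sup>2 / c / (2 * tanh (z / 2))"
    by (simp add: mean_time_def add_divide_distrib z_def)
  have bound: "(c - x)\<^sup>2 / c / (2 * e) < mean_time lam c x 0" if "tanh (z / 2) \<le> e" for e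
  proof -
    have "e > 0"
      using that pos by linarith
    then have "0 < 2 * e * (2 * tanh (z / 2))"
      using pos by (intro mult_pos_pos) linarith+
    moreover have "0 \<le> (c - x)\<^sup>2 / c"
      using assms by simp
    ultimately have "(c - x)\<^sup>2 / c / (2 * e) \<le> (c - x)\<^sup>2 / c / (2 * tanh (z / 2))"
      using that by (intro divide_left_mono) simp_all
    then show ?thesis
      using eq first by linarith
  qed
  show "(c - x)\<^sup>2 / (2 * c) < mean_time lam c x 0"
    using bound[of 1] tanh_real_lt_1[of "z / 2"] by (simp add: mult.commute)
  have "(1 - exp (- z)) / (1 + exp (- z)) \<le> (1 - exp (- z)) / 1"
    using z by (intro divide_left_mono) (auto intro: add_pos_pos)
  also have "\<dots> \<le> z"
    using exp_ge_add_one_self[of "- z"] by simp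
  finally have "tanh (z / 2) \<le> z"
    by (simp only: half_tanh)
  from bound[OF this] show "(c - x)\<^sup>2 / (2 * lam * x * c) < mean_time lam c x 0"
    by (simp add: z_def mult.commute mult.left_commute)
qed

lemma mean_time_less:
  assumes "lam > 0" "x > 0" "c > 0" "Q > 0"
  shows "mean_time lam c x Q < mean_time lam c x 0"
  using assms by (simp add: mean_time_def divide_strict_right_mono)

lemma tendsto_mean_time:
  assumes "(c \<longlongrightarrow> c0) F" "(x \<longlongrightarrow> x0) F" "(Q \<longlongrightarrow> Q0) F" "lam > 0" "c0 \<noteq> 0" "x0 > 0"
  shows "((\<lambda>t. mean_time lam (c t) (x t) (Q t)) \<longlongrightarrow> mean_time lam c0 x0 Q0) F"
  unfolding mean_time_def using assms(4-6)
  by (intro tendsto_intros assms(1-3)) auto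

section \<open>Optimal search times for simple cycles\<close>

lemma continuous_on_Max_image:
  fixes f :: "'i \<Rightarrow> 'a :: topological_space \<Rightarrow> real"
  assumes "finite I" "I \<noteq> {}" "\<And>i. i \<in> I \<Longrightarrow> continuous_on S (f i)"
  shows "continuous_on S (\<lambda>x. Max ((\<lambda>i. f i x) ` I))"
  using assms by (induction I rule: finite_ne_induct) (auto intro: continuous_on_max)

text \<open>The performance of a simple cycle with search times \<open>x\<close> whose travel time is \<open>T\<close>.\<close>
definition worst_time :: "nat \<Rightarrow> real \<Rightarrow> (nat \<Rightarrow> real) \<Rightarrow> (nat \<Rightarrow> real) \<Rightarrow> real" where
  "worst_time n T lam x = Max ((\<lambda>i. mean_time (lam i) (T + (\<Sum>j=1..n. x j)) (x i) 0) ` {1..n})"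

lemma worst_time_ge:
  assumes "i \<in> {1..n}"
  shows "mean_time (lam i) (T + (\<Sum>j=1..n. x j)) (x i) 0 \<le> worst_time n T lam x"
  unfolding worst_time_def using assms by (intro Max_ge) auto

text \<open>A good performance confines the search times to a compact box. Of two locations, one has at
most half of the cycle, which bounds the cycle length \<open>c\<close> by \<open>8 * M\<close>; then each search has to be long
enough because every location has a gap of at least \<open>T\<close>.\<close>
lemma worst_time_bounds:
  assumes "n \<ge> 2" "T > 0" "\<And>i. i \<in> {1..n} \<Longrightarrow> lam i > 0"
    and x: "\<And>i. i \<in> {1..n} \<Longrightarrow> x i > 0"
    and M: "worst_time n T lam x \<le> M"
    and i: "i \<in> {1..n}"
  shows "x i \<le> 8 * M" "T\<^sup>2 \<le> 16 * M\<^sup>2 * lam i * x i"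
proof -
  define c where "c = T + (\<Sum>j=1..n. x j)"
  have le_c: "x j + T \<le> c" if "j \<in> {1..n}" for j
    using member_le_sum[of j "{1..n}" x] that x by (force simp: c_def less_imp_le)
  have less_c: "x j < c" if "j \<in> {1..n}" for j
    using le_c[OF that] assms(2) by simp
  have mean_le: "mean_time (lam j) c (x j) 0 \<le> M" if "j \<in> {1..n}" for j
    using worst_time_ge[OF that, of lam T x] M by (simp add: c_def)
  have "c > 0"
    using less_c[OF i] x[OF i] by simp
  have one_two: "1 \<in> {1..n}" "2 \<in> {1..n}"
    using assms(1) by auto
  have "x 1 + x 2 = (\<Sum>j\<in>{1, 2}. x j)"
    by simp
  also have "\<dots> \<le> (\<Sum>j=1..n. x j)"
    using one_two x by (intro sum_mono2) (auto simp: less_imp_le)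
  finally have "x 1 + x 2 \<le> c"
    using assms(2) by (simp add: c_def)
  then obtain j where j: "j \<in> {1..n}" "x j \<le> c / 2"
  proof (cases "x 1 \<le> x 2")
    case True
    then show ?thesis using that[of 1] one_two \<open>x 1 + x 2 \<le> c\<close> by simp
  next
    case False
    then show ?thesis using that[of 2] one_two \<open>x 1 + x 2 \<le> c\<close> by simp
  qed
  have "(c / 2)\<^sup>2 \<le> (c - x j)\<^sup>2"
    using j \<open>c > 0\<close> by (intro power_mono) auto
  then have "(c / 2)\<^sup>2 / (2 * c) \<le> (c - x j)\<^sup>2 / (2 * c)"
    using \<open>c > 0\<close> by (intro divide_right_mono) auto
  also have "\<dots> < mean_time (lam j) c (x j) 0"
    using assms(3) x j less_c by (intro mean_time_bounds) auto
  also have "\<dots> \<le> M"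
    using mean_le j by simp
  finally have c_le: "c \<le> 8 * M"
    using \<open>c > 0\<close> by (simp add: power2_eq_square field_simps)
  then show "x i \<le> 8 * M"
    using less_c[OF i] by simp
  define D where "D = 2 * lam i * x i"
  have "D > 0"
    using assms(3) x i by (simp add: D_def)
  have "T\<^sup>2 \<le> (c - x i)\<^sup>2"
    using le_c[OF i] assms(2) by (intro power_mono) auto
  then have "T\<^sup>2 / (D * c) \<le> (c - x i)\<^sup>2 / (D * c)"
    using \<open>c > 0\<close> \<open>D > 0\<close> by (intro divide_right_mono) auto
  also have "\<dots> \<le> M"
    using mean_time_bounds(2)[of "lam i" "x i" c] assms(3) x i less_c mean_le[OF i] by (simp add: D_def)
  finally have "T\<^sup>2 \<le> M * (D * c)"
    using \<open>c > 0\<close> \<open>D > 0\<close> by (simp add: pos_divide_le_eq)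
  also have "\<dots> \<le> M * (D * (8 * M))"
    using c_le \<open>c > 0\<close> \<open>D > 0\<close> by (intro mult_left_mono) auto
  finally show "T\<^sup>2 \<le> 16 * M\<^sup>2 * lam i * x i"
    by (simp add: D_def power2_eq_square algebra_simps)
qed

text \<open>The infimum is attained: search times at least as good as \<open>1, \<dots>, 1\<close> lie in a box bounded away from
zero, the box is compact by Tychonoff's theorem, and the worst time is continuous on it.\<close>
lemma worst_time_attains_min:
  assumes "n \<ge> 2" "T > 0" and lam: "\<And>i. i \<in> {1..n} \<Longrightarrow> lam i > 0"
  obtains x where "\<And>i. i \<in> {1..n} \<Longrightarrow> x i > 0"
    "\<And>z. (\<And>i. i \<in> {1..n} \<Longrightarrow> z i > 0) \<Longrightarrow> worst_time n T lam x \<le> worst_time n T lam z"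
proof -
  define M where "M = worst_time n T lam (\<lambda>_. 1)"
  define L where "L = (\<Sum>i=1..n. lam i)"
  define a where "a = T\<^sup>2 / (16 * M\<^sup>2 * L)"
  define b where "b = 8 * M"
  have lam_le: "lam i \<le> L" if "i \<in> {1..n}" for i
    unfolding L_def using that lam by (intro member_le_sum) (auto simp: less_imp_le)
  have "L > 0"
    unfolding L_def using assms(1) lam by (intro sum_pos) auto
  have box: "z i \<in> {a..b}"
    if z: "\<And>i. i \<in> {1..n} \<Longrightarrow> z i > 0" and le: "worst_time n T lam z \<le> M" and i: "i \<in> {1..n}" for z i
  proof -
    note bounds = worst_time_bounds[OF assms(1,2) lam z le i]
    have "T\<^sup>2 \<le> 16 * M\<^sup>2 * lam i * z i"
      by (rule bounds(2))
    also have "\<dots> \<le> 16 * M\<^sup>2 * L * z i"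
      using lam_le[OF i] z[OF i] by (intro mult_right_mono mult_left_mono) auto
    finally have *: "T\<^sup>2 \<le> 16 * M\<^sup>2 * L * z i" .
    then have "M \<noteq> 0"
      using assms(2) by auto
    then have "a \<le> z i"
      using * \<open>L > 0\<close> by (simp add: a_def pos_divide_le_eq mult.commute)
    then show ?thesis
      using bounds(1) by (simp add: b_def)
  qed
  have one: "1 \<in> {a..b}"
    using box[of "\<lambda>_. 1" 1] assms(1) by (simp add: M_def)
  have "M \<noteq> 0"
    using one by (auto simp: b_def)
  then have "a > 0"
    using assms(2) \<open>L > 0\<close> by (simp add: a_def)
  define K where "K = {x :: nat \<Rightarrow> real. \<forall>i. x i \<in> {a..b}}"
  have "K = (\<Pi>\<^sub>E i\<in>UNIV. {a..b})"
    by (auto simp: K_def PiE_iff)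
  then have "compactin (product_topology (\<lambda>_. euclidean) UNIV) K"
    by (simp add: compactin_PiE)
  then have "compact K"
    by (simp only: euclidean_product_topology compactin_euclidean_iff)
  moreover have "(\<lambda>_. 1) \<in> K"
    using one by (simp add: K_def)
  moreover have "continuous_on K (worst_time n T lam)"
    unfolding worst_time_def
  proof (intro continuous_on_Max_image)
    fix i assume i: "i \<in> {1..n}"
    show "continuous_on K (\<lambda>x. mean_time (lam i) (T + (\<Sum>j=1..n. x j)) (x i) 0)"
      unfolding continuous_on_def
    proof
      fix x assume "x \<in> K"
      then have "x j > 0" for j
        using \<open>a > 0\<close> by (auto simp: K_def intro: less_le_trans)
      moreover from this have "(\<Sum>j=1..n. x j) \<ge> 0"
        by (intro sum_nonneg) (auto simp: less_imp_le)
      moreover have "((\<lambda>x. x j) \<longlongrightarrow> x j) (at x within K)" for j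
        using continuous_on_product_coordinates[of j] continuous_on_subset subset_UNIV \<open>x \<in> K\<close>
        unfolding continuous_on_def by blast
      ultimately show "((\<lambda>x. mean_time (lam i) (T + (\<Sum>j=1..n. x j)) (x i) 0) \<longlongrightarrow>
          mean_time (lam i) (T + (\<Sum>j=1..n. x j)) (x i) 0) (at x within K)"
        using lam[OF i] assms(2) by (intro tendsto_mean_time tendsto_intros) auto
    qed
  qed (use assms(1) in auto)
  ultimately obtain x where x: "x \<in> K" "\<And>z. z \<in> K \<Longrightarrow> worst_time n T lam x \<le> worst_time n T lam z"
    using continuous_attains_inf[of K "worst_time n T lam"] by auto
  show ?thesis
  proof (rule that)
    show "x i > 0" for i
      using x(1) \<open>a > 0\<close> by (auto simp: K_def intro: less_le_trans)
    fix z :: "nat \<Rightarrow> real" assume z: "\<And>i. i \<in> {1..n} \<Longrightarrow> z i > 0"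
    show "worst_time n T lam x \<le> worst_time n T lam z"
    proof (cases "worst_time n T lam z \<le> M")
      case True
      \<comment> \<open>The box constrains all natural numbers, so a value has to be chosen outside \<open>{1..n}\<close>.\<close>
      define z' where "z' = (\<lambda>i. if i \<in> {1..n} then z i else 1)"
      have "z' \<in> K"
        using box[OF z True] one by (simp add: K_def z'_def)
      moreover have "worst_time n T lam z' = worst_time n T lam z"
        unfolding worst_time_def z'_def by (intro arg_cong[where f = Max] image_cong) auto
      ultimately show ?thesis
        using x(2) by force
    next
      case False
      then show ?thesis
        using x(2)[OF \<open>(\<lambda>_. 1) \<in> K\<close>] by (simp add: M_def)
    qed
  qed
qed

section \<open>Sweep cycles against simple cycles\<close>

text \<open>Dividing each search time equally between the two visits of a sweep strictly improves every interior
location, as both of its gaps are positive, and leaves the two ends unchanged. To improve the ends as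
well, take a little time \<open>\<epsilon>\<close> away from the search at location \<open>2\<close>, which is interior as \<open>n \<ge> 3\<close>: the
cycle and hence the gaps at the ends get shorter, while the strict improvement of the interior
locations survives by continuity.\<close>
lemma sweep_improves_simple:
  assumes "travel_times n d" "n \<ge> 3" and lam: "\<And>i. i \<in> {1..n} \<Longrightarrow> lam i > 0"
    and x: "\<And>i. i \<in> {1..n} \<Longrightarrow> x i > 0"
    and V: "worst_time n (round_trip n d) lam x \<le> V"
  obtains p where "p \<in> sweep_cycles n" "performance n d lam p < ennreal V"
proof -
  define c where "c = (\<lambda>z. round_trip n d + (\<Sum>i=1..n. z i))"
  define val where "val = (\<lambda>z i. mean_time (lam i) (c z) (z i) (return_gap d z i * (c z - z i - return_gap d z i)))"
  define w where "w = (\<lambda>\<epsilon>. x(2 := x 2 - \<epsilon>))"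
  \<comment> \<open>The other gap at \<open>i\<close>, for the way through \<open>i + 1, \<dots>, n\<close> and back.\<close>
  have c_eq: "c z - z i - return_gap d z i = (\<Sum>j=i..<n. d j (j + 1) + d (j + 1) j + z (j + 1))" if "i \<in> {1..n}" for z i
  proof -
    have 1: "round_trip n d = (\<Sum>j=1..<i. d j (j + 1) + d (j + 1) j) + (\<Sum>j=i..<n. d j (j + 1) + d (j + 1) j)"
      unfolding round_trip_def using that by (intro sum.atLeastLessThan_concat[symmetric]) auto
    have "{1..n} = {1..<Suc n}" by auto
    then have "(\<Sum>i=1..n. z i) = (\<Sum>j=1..<i. z j) + (\<Sum>j=i..<Suc n. z j)"
      using that by (simp add: sum.atLeastLessThan_concat)
    also have "(\<Sum>j=i..<Suc n. z j) = z i + (\<Sum>j=Suc i..<Suc n. z j)"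
      using that by (intro sum.atLeast_Suc_lessThan) auto
    also have "(\<Sum>j=Suc i..<Suc n. z j) = (\<Sum>j=i..<n. z (j + 1))"
      using sum.shift_bounds_Suc_ivl[of z i n] by simp
    finally show ?thesis
      unfolding c_def 1 return_gap_def by (simp add: sum.distrib)
  qed
  have d_pos: "d j (j + 1) > 0" "d (j + 1) j > 0" if "j \<in> {1..<n}" for j
    using assms(1) that unfolding travel_times_def by auto
  have round_trip_pos: "round_trip n d > 0"
    unfolding round_trip_def using assms(2) d_pos by (intro sum_pos add_pos_pos) auto
  have c_pos: "c x > x i" if "i \<in> {1..n}" for i
    using member_le_sum[of i "{1..n}" x] that x round_trip_pos by (force simp: c_def less_imp_le)
  have base: "mean_time (lam i) (c x) (x i) 0 \<le> V" if "i \<in> {1..n}" for i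
    using worst_time_ge[OF that, of lam "round_trip n d" x] V by (simp add: c_def)
  have V_pos: "V > 0"
  proof -
    have 1: "1 \<in> {1..n}"
      using assms(2) by simp
    have "0 \<le> (c x - x 1)\<^sup>2 / (2 * c x)"
      using x[OF 1] c_pos[OF 1] by simp
    also have "\<dots> < mean_time (lam 1) (c x) (x 1) 0"
      using lam x c_pos 1 by (intro mean_time_bounds) auto
    also have "\<dots> \<le> V"
      using base 1 by simp
    finally show ?thesis .
  qed
  have two: "2 \<in> {1..n}"
    using assms(2) by auto
  have tendsto_w: "((\<lambda>\<epsilon>. w \<epsilon> j) \<longlongrightarrow> x j) (at_right 0)" for j
    unfolding w_def by (cases "j = 2") (auto intro!: tendsto_eq_intros)
  have c_w: "c (w \<epsilon>) = c x - \<epsilon>" for \<epsilon>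
    using sum.remove[of "{1..n}" 2 x] sum.remove[of "{1..n}" 2 "w \<epsilon>"] two
    by (simp add: c_def w_def)
  have small: "eventually (\<lambda>\<epsilon>. 0 < \<epsilon> \<and> \<epsilon> < x 2) (at_right 0)"
    using x[OF two] by (auto simp: eventually_at_right_field)
  have end_less: "eventually (\<lambda>\<epsilon>. val (w \<epsilon>) i < V) (at_right 0)" if i: "i \<in> {1, n}" for i
    using small
  proof eventually_elim
    case (elim \<epsilon>)
    have i': "i \<in> {1..n}" "i \<noteq> 2"
      using i assms(2) by auto
    have Q: "return_gap d (w \<epsilon>) i * (c (w \<epsilon>) - w \<epsilon> i - return_gap d (w \<epsilon>) i) = 0"
      using i unfolding c_eq[OF i'(1)] by (auto simp: return_gap_def)
    have "val (w \<epsilon>) i = mean_time (lam i) (c x - \<epsilon>) (x i) 0"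
      unfolding val_def Q using i' by (simp add: c_w) (simp add: w_def)
    also have "\<dots> < mean_time (lam i) (c x) (x i) 0"
    proof (rule mean_time_mono(2))
      have "x 2 + x i = (\<Sum>j\<in>{2, i}. x j)"
        using i' by simp
      also have "\<dots> \<le> (\<Sum>j=1..n. x j)"
        using two i' x by (intro sum_mono2) (auto simp: less_imp_le)
      finally show "x i \<le> c x - \<epsilon>"
        using elim round_trip_pos by (simp add: c_def)
    qed (use lam x i' elim in auto)
    also have "\<dots> \<le> V"
      using base i' by simp
    finally show ?case .
  qed
  have interior_less: "eventually (\<lambda>\<epsilon>. val (w \<epsilon>) i < V) (at_right 0)" if i: "i \<in> {1<..<n}" for i
  proof -
    have i': "i \<in> {1..n}"
      using i by auto
    have "return_gap d x i > 0"
      unfolding return_gap_def using i d_pos x by (intro sum_pos add_pos_pos) auto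
    moreover have "c x - x i - return_gap d x i > 0"
      unfolding c_eq[OF i'] using i d_pos x by (intro sum_pos add_pos_pos) auto
    ultimately have "val x i < mean_time (lam i) (c x) (x i) 0"
      unfolding val_def using lam x i' c_pos[OF i'] by (intro mean_time_less) (auto intro: less_trans)
    then have "val x i < V"
      using base[OF i'] by simp
    moreover have "((\<lambda>\<epsilon>. val (w \<epsilon>) i) \<longlongrightarrow> val x i) (at_right 0)"
      unfolding val_def c_def return_gap_def
      using lam[OF i'] x[OF i'] c_pos[OF i'] unfolding c_def
      by (intro tendsto_mean_time tendsto_intros tendsto_w) auto
    ultimately show ?thesis
      by (intro order_tendstoD)
  qed
  have "eventually (\<lambda>\<epsilon>. \<forall>i\<in>{1..n}. val (w \<epsilon>) i < V) (at_right 0)"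
  proof (intro eventually_ball_finite ballI)
    fix i assume "i \<in> {1..n}"
    then show "eventually (\<lambda>\<epsilon>. val (w \<epsilon>) i < V) (at_right 0)"
      using end_less[of i] interior_less[of i] by force
  qed simp
  with small have "eventually (\<lambda>\<epsilon>. 0 < \<epsilon> \<and> \<epsilon> < x 2 \<and> (\<forall>i\<in>{1..n}. val (w \<epsilon>) i < V)) (at_right 0)"
    by eventually_elim auto
  then have "\<exists>\<epsilon>. 0 < \<epsilon> \<and> \<epsilon> < x 2 \<and> (\<forall>i\<in>{1..n}. val (w \<epsilon>) i < V)"
    by (rule eventually_happens'[rotated]) simp
  then obtain \<epsilon> where \<epsilon>: "0 < \<epsilon>" "\<epsilon> < x 2" "\<And>i. i \<in> {1..n} \<Longrightarrow> val (w \<epsilon>) i < V"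
    by blast
  have w_pos: "w \<epsilon> i > 0" if "i \<in> {1..n}" for i
    using x[OF that] \<epsilon> by (simp add: w_def)
  have "n \<ge> 1"
    using assms(2) by simp
  obtain p where p: "p \<in> sweep_cycles n"
    "\<And>i. i \<in> {1..n} \<Longrightarrow> detection_time d lam p i = ennreal (val (w \<epsilon>) i)"
    by (rule sweep_cycle_detection_time[where x = "w \<epsilon>" and lam = lam and c = "c (w \<epsilon>)",
          OF assms(1) \<open>n \<ge> 1\<close>])
      (erule w_pos, erule lam, simp add: c_def, rule that, assumption, simp add: val_def)
  have "performance n d lam p < ennreal V"
    unfolding performance_def using p(2) \<epsilon>(3) V_pos assms(2)
    by (subst Max_less_iff) (auto intro!: ennreal_lessI)
  with p(1) show ?thesis
    by (rule that)
qed

lemma simple_cycle_performance_ge: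
  assumes "line_network n d" "n \<ge> 2" and lam: "\<And>i. i \<in> {1..n} \<Longrightarrow> lam i > 0"
    and p: "p \<in> simple_cycles n"
    and V: "\<And>x. (\<And>i. i \<in> {1..n} \<Longrightarrow> x i > 0) \<Longrightarrow> V \<le> worst_time n (round_trip n d) lam x"
    and "round_trip n d \<ge> 0"
  shows "ennreal V \<le> performance n d lam p"
proof -
  obtain x c where x: "\<And>i. i \<in> {1..n} \<Longrightarrow> x i > 0"
    and c: "c \<ge> round_trip n d + (\<Sum>i=1..n. x i)"
    and det: "\<And>i. i \<in> {1..n} \<Longrightarrow> detection_time d lam p i = ennreal (mean_time (lam i) c (x i) 0)"
    by (rule simple_cycle_detection_time[where lam = lam, OF assms(1,2) p]) (erule lam, rule that)
  define C where "C = round_trip n d + (\<Sum>i=1..n. x i)"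
  have "worst_time n (round_trip n d) lam x \<in> (\<lambda>i. mean_time (lam i) C (x i) 0) ` {1..n}"
    unfolding worst_time_def C_def using assms(2) by (intro Max_in) auto
  then obtain i where i: "i \<in> {1..n}" "worst_time n (round_trip n d) lam x = mean_time (lam i) C (x i) 0"
    by blast
  have "x i \<le> C"
    using member_le_sum[of i "{1..n}" x] i x assms(6) by (force simp: C_def less_imp_le)
  have "V \<le> mean_time (lam i) C (x i) 0"
    using V[of x] x i by simp
  also have "\<dots> \<le> mean_time (lam i) c (x i) 0"
    using c lam x i \<open>x i \<le> C\<close> by (intro mean_time_mono) (auto simp: C_def)
  finally have "ennreal V \<le> detection_time d lam p i"
    using det i by (simp add: ennreal_leI)
  also have "\<dots> \<le> performance n d lam p"
    unfolding performance_def using i by (intro Max_ge) auto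
  finally show ?thesis .
qed

theorem theorem5p2:
  fixes n :: nat and d :: "nat \<Rightarrow> nat \<Rightarrow> real" and lam :: "nat \<Rightarrow> real"
  assumes "n \<ge> 3"
    and "line_network n d"
    and "\<And>i. i \<in> {1..n} \<Longrightarrow> lam i > 0"
  shows "(INF p \<in> sweep_cycles n. performance n d lam p)
       < (INF p \<in> simple_cycles n. performance n d lam p)"
proof -
  have n: "n \<ge> 2"
    using assms(1) by simp
  have tt: "travel_times n d"
    using assms(2) by (simp add: line_network_def)
  have "d 1 n > 0" "d n 1 > 0"
    using tt n unfolding travel_times_def by auto
  then have T: "round_trip n d > 0"
    using line_network_round_trip[OF assms(2) n] by simp
  obtain x where x: "\<And>i. i \<in> {1..n} \<Longrightarrow> x i > 0"
    "\<And>z. (\<And>i. i \<in> {1..n} \<Longrightarrow> z i > 0) \<Longrightarrow>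
        worst_time n (round_trip n d) lam x \<le> worst_time n (round_trip n d) lam z"
    using worst_time_attains_min[where lam = lam, OF n T assms(3)] by blast
  define V where "V = worst_time n (round_trip n d) lam x"
  obtain p where p: "p \<in> sweep_cycles n" "performance n d lam p < ennreal V"
    using sweep_improves_simple[where lam = lam and x = x, OF tt assms(1,3) x(1)] unfolding V_def by blast
  have "(INF p \<in> sweep_cycles n. performance n d lam p) \<le> performance n d lam p"
    using p(1) by (rule INF_lower)
  also note p(2)
  also have "ennreal V \<le> (INF p \<in> simple_cycles n. performance n d lam p)"
    using simple_cycle_performance_ge[OF assms(2) n assms(3), where V = V] x(2) T
    by (intro INF_greatest) (simp add: V_def)
  finally show ?thesis .
qed

end
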